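(* There exist LKTSs (large sets of Kirkman triple systems) of orders $93$, $177$, $219$, $261$ and $303$; that is, an LKTS$(v)$ exists for each $v\in\{93,177,219,261,303\}$.
   Context: A Steiner triple system STS$(v)$ is a pair $(X,\mathcal B)$, where $X$ is a $v$-set and $\mathcal B$ is a collection of $3$-subsets (blocks) of $X$ such that every pair of points of $X$ is contained in a unique block. A parallel class is a set of blocks that partitions $X$. An STS$(v)$ is resolvable if $\mathcal B$ can be partitioned into $(v-1)/2$ parallel classes; a resolvable STS$(v)$ is called a Kirkman triple system KTS$(v)$. Two STS$(v)$s on the same point set are disjoint if they have no common block. A large set of Steiner triple systems LSTS$(v)$ is a set of $v-2$ mutually disjoint STS$(v)$s on the same $v$-point set (equivalently, their block sets partition all triples of the point set). An LKTS$(v)$ is an LSTS$(v)$ in which every constituent STS$(v)$ is resolvable. *)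

theory Defs
  imports Main "HOL-Library.Disjoint_Sets"
begin

definition steiner_triple_system :: "nat \<Rightarrow> 'a set \<Rightarrow> 'a set set \<Rightarrow> bool" where
  "steiner_triple_system v X \<B> \<longleftrightarrow>
     finite X \<and> card X = v \<and>
     (\<forall>B\<in>\<B>. B \<subseteq> X \<and> card B = 3) \<and>
     (\<forall>x\<in>X. \<forall>y\<in>X. x \<noteq> y \<longrightarrow> (\<exists>!B. B \<in> \<B> \<and> {x, y} \<subseteq> B))"

definition parallel_class :: "'a set \<Rightarrow> 'a set set \<Rightarrow> 'a set set \<Rightarrow> bool" where
  "parallel_class X \<B> P \<longleftrightarrow> P \<subseteq> \<B> \<and> partition_on X P"

(* A nonempty Steiner triple system has odd order, so the division by 2 is exact. *)
definition resolvable :: "nat \<Rightarrow> 'a set \<Rightarrow> 'a set set \<Rightarrow> bool" where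
  "resolvable v X \<B> \<longleftrightarrow>
     (\<exists>\<R>. partition_on \<B> \<R> \<and> card \<R> = (v - 1) div 2 \<and> (\<forall>P\<in>\<R>. parallel_class X \<B> P))"

definition kirkman_triple_system :: "nat \<Rightarrow> 'a set \<Rightarrow> 'a set set \<Rightarrow> bool" where
  "kirkman_triple_system v X \<B> \<longleftrightarrow> steiner_triple_system v X \<B> \<and> resolvable v X \<B>"

(* The point set X is common to the whole large set, so each system of the
   collection is given by its block set alone. *)
definition large_set_STS :: "nat \<Rightarrow> 'a set \<Rightarrow> 'a set set set \<Rightarrow> bool" where
  "large_set_STS v X \<L> \<longleftrightarrow>
     card \<L> = v - 2 \<and> (\<forall>\<B>\<in>\<L>. steiner_triple_system v X \<B>) \<and> pairwise disjnt \<L>"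

definition large_set_KTS :: "nat \<Rightarrow> 'a set \<Rightarrow> 'a set set set \<Rightarrow> bool" where
  "large_set_KTS v X \<L> \<longleftrightarrow>
     large_set_STS v X \<L> \<and> (\<forall>\<B>\<in>\<L>. kirkman_triple_system v X \<B>)"

end

(*
  Let H be the additive group of the field with n = 13, 25, 31, 37 or 43 elements, w a primitive cube
  root of unity, and let the points be Z_7 x H with two points at infinity.  A Kirkman triple system B
  is put together from a KTS(n + 2) on the fibre over 0 and the infinite points, and from blocks whose
  Z_7-coordinates sum to 0 and whose H-coordinates satisfy one linear relation each.  One parallel
  class P0 yields 3n parallel classes by translation along H and multiplication of Z_7 by the squares;
  each of the (n + 1)/2 parallel classes of the KTS(n + 2) is completed by two families of translates.
  The 7n images of B under (x, h) -> (x + a, h + mu(x) j) form a large set: the Z_7-coordinates of a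
  triple determine a, and then mu is such that the linear relation can be solved for j.  Both that B is
  a Steiner system and that its images are disjoint are deduced by counting from the fact that every
  pair, respectively every triple, is covered.  The KTS(n + 2) and P0 were found by computer search.
*)

theory Submission
  imports Defs "HOL-Library.Numeral_Type" "HOL-Library.Multiset"
begin

section \<open>Covering criteria for Kirkman triple systems and large sets\<close>

text \<open>Every linear relation is invariant under adding a constant to all H-coordinates. This
  keeps the translates of \<open>P0\<close> inside the system, but it is also the obstacle to a
  large set: moving all fibres equally would only permute the blocks outside the small system. The
  shift must therefore depend on the fibre, with weights that give \<open>j\<close> an invertible
  coefficient in each relation. Up to order, a zero-sum triple modulo 7 is (0,0,0), (0,d,-d),
  (x,x,-2x) or (k,2k,4k). The first type is left to the small system; the other relations, for
  H-coordinates in this order, are h2 + h3 = 2 h1, h1 + h2 = 2 h3 and h3 - h2 = \<omega> (h2 - h1).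
  The last is cyclically symmetric because 1 + \<omega> + \<omega>^2 = 0, in step with doubling,
  which has order 3 modulo 7. The relation for (x,x,-2x) degenerates when the H-coordinates agree,
  and the two infinite points take up the pairs left over.\<close>

lemma disjoint_if_sum_card_le_card_UN:
  assumes "finite I" "\<And>i. i \<in> I \<Longrightarrow> finite (f i)"
    and le: "(\<Sum>i\<in>I. card (f i)) \<le> card (\<Union>i\<in>I. f i)"
    and ij: "i \<in> I" "j \<in> I" "i \<noteq> j"
  shows "f i \<inter> f j = {}"
proof (rule ccontr)
  assume ne: "f i \<inter> f j \<noteq> {}"
  \<comment> \<open>If \<open>f i\<close> meets \<open>f j\<close>, the union survives replacing
    \<open>f i\<close> by the strictly smaller \<open>f i - f j\<close>, so it has fewer elements
    than the sum of the sizes.\<close>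
  have "(\<Union>i\<in>I. f i) = (f i - f j) \<union> (\<Union>k\<in>I - {i}. f k)"
    using ij by auto
  then have "card (\<Union>i\<in>I. f i) \<le> card (f i - f j) + card (\<Union>k\<in>I - {i}. f k)"
    by (metis card_Un_le)
  also have "card (\<Union>k\<in>I - {i}. f k) \<le> (\<Sum>k\<in>I - {i}. card (f k))"
    using assms(1) by (intro card_UN_le) auto
  also have "card (f i - f j) < card (f i)"
    using ne assms(2) ij by (intro psubset_card_mono) auto
  finally have "card (\<Union>i\<in>I. f i) < card (f i) + (\<Sum>k\<in>I - {i}. card (f k))"
    by simp
  also have "\<dots> = (\<Sum>i\<in>I. card (f i))"
    using assms(1) ij by (simp add: sum.remove)
  finally show False using le by simp
qed

text \<open>The (v - 1)/2 partitions consist of v/3 triples each, and a triple holds 3 pairs. This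
  gives v(v - 1)/2 incidences, the number of all pairs, so a covering leaves no room for covering a
  pair twice.\<close>

lemma kirkman_triple_systemI:
  fixes C :: "'i \<Rightarrow> 'a set set"
  assumes X: "finite X" "card X = v" and v: "v = 2 * card I + 1" and I: "finite I"
    and part: "\<And>i. i \<in> I \<Longrightarrow> partition_on X (C i)"
    and card3: "\<And>i B. i \<in> I \<Longrightarrow> B \<in> C i \<Longrightarrow> card B = 3"
    and cover: "\<And>x y. x \<in> X \<Longrightarrow> y \<in> X \<Longrightarrow> x \<noteq> y \<Longrightarrow> \<exists>i\<in>I. \<exists>B\<in>C i. {x, y} \<subseteq> B"
  shows "kirkman_triple_system v X (\<Union>i\<in>I. C i)"
proof -
  define pairs where "pairs B = {S. S \<subseteq> B \<and> card S = 2}" for B :: "'a set"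
  \<comment> \<open>Blocks are counted together with their class: a block shared by two classes
    would count twice, so the same bound also makes the classes disjoint.\<close>
  let ?T = "SIGMA i:I. C i"
  have sub: "B \<subseteq> X" if "i \<in> I" "B \<in> C i" for i B
    using part[OF that(1)] that(2) by (auto simp: partition_on_def)
  have finB: "finite B" if "i \<in> I" "B \<in> C i" for i B
    using sub[OF that] X finite_subset by blast
  have finC: "finite (C i)" if "i \<in> I" for i
    using part[OF that] X finite_elements by blast
  have cardC: "3 * card (C i) = v" if i: "i \<in> I" for i
  proof -
    have "card (\<Union>(C i)) = (\<Sum>B\<in>C i. card B)"
      using part[OF i] finB[OF i] by (intro card_Union_disjoint) (auto simp: partition_on_def disjoint_def disjnt_def pairwise_def)
    also have "\<dots> = 3 * card (C i)"
      using card3[OF i] by simp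
    finally show ?thesis
      using part[OF i] X by (simp add: partition_on_def)
  qed
  have pairs3: "card (pairs B) = 3" if "i \<in> I" "B \<in> C i" for i B
    using n_subsets[OF finB[OF that], of 2] card3[OF that]
    by (simp add: pairs_def choose_two)
  have UN: "(\<Union>p\<in>?T. pairs (snd p)) = pairs X"
  proof (intro equalityI subsetI)
    fix S assume "S \<in> pairs X"
    then obtain x y where S: "S = {x, y}" "x \<noteq> y" "x \<in> X" "y \<in> X"
      by (auto simp: pairs_def card_2_iff)
    obtain i B where "i \<in> I" "B \<in> C i" "{x, y} \<subseteq> B"
      using cover[OF S(3,4,2)] by blast
    then have "(i, B) \<in> ?T" "S \<in> pairs B"
      using S by (auto simp: pairs_def)
    then show "S \<in> (\<Union>p\<in>?T. pairs (snd p))" by force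
  next
    fix S assume "S \<in> (\<Union>p\<in>?T. pairs (snd p))"
    then obtain i B where "i \<in> I" "B \<in> C i" "S \<in> pairs B" by auto
    then show "S \<in> pairs X"
      using sub[of i B] by (auto simp: pairs_def)
  qed
  have "(\<Sum>p\<in>?T. card (pairs (snd p))) = (\<Sum>i\<in>I. \<Sum>B\<in>C i. card (pairs B))"
    using I finC by (simp add: sum.Sigma split_def)
  also have "\<dots> = (\<Sum>i\<in>I. v)"
    using pairs3 cardC by (intro sum.cong refl) (simp add: mult.commute)
  also have "\<dots> = v choose 2"
    using v by (simp add: choose_two)
  also have "\<dots> = card (pairs X)"
    using X n_subsets[of X 2] by (simp add: pairs_def)
  finally have le: "(\<Sum>p\<in>?T. card (pairs (snd p))) \<le> card (\<Union>p\<in>?T. pairs (snd p))"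
    using UN by simp
  have disj: "pairs B \<inter> pairs B' = {}"
    if "i \<in> I" "B \<in> C i" "j \<in> I" "B' \<in> C j" "(i, B) \<noteq> (j, B')" for i j B B'
  proof -
    have "pairs (snd (i, B)) \<inter> pairs (snd (j, B')) = {}"
      by (rule disjoint_if_sum_card_le_card_UN[OF _ _ le])
        (use that I finC finB in \<open>auto simp: pairs_def\<close>)
    then show ?thesis by simp
  qed
  have uniq: "i = j \<and> B = B'"
    if "i \<in> I" "B \<in> C i" "j \<in> I" "B' \<in> C j" "{x, y} \<subseteq> B" "{x, y} \<subseteq> B'" "x \<noteq> y" for i j B B' x y
  proof -
    have "{x, y} \<in> pairs B \<inter> pairs B'"
      using that by (auto simp: pairs_def)
    then show ?thesis
      using disj that by blast
  qed
  have "steiner_triple_system v X (\<Union>i\<in>I. C i)"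
    unfolding steiner_triple_system_def
  proof (intro conjI ballI impI)
    fix x y assume xy: "x \<in> X" "y \<in> X" "x \<noteq> y"
    obtain i B where iB: "i \<in> I" "B \<in> C i" "{x, y} \<subseteq> B"
      using cover[OF xy] by blast
    show "\<exists>!B. B \<in> (\<Union>i\<in>I. C i) \<and> {x, y} \<subseteq> B"
    proof (rule ex1I[of _ B])
      show "B \<in> (\<Union>i\<in>I. C i) \<and> {x, y} \<subseteq> B"
        using iB by blast
    next
      fix B' assume "B' \<in> (\<Union>i\<in>I. C i) \<and> {x, y} \<subseteq> B'"
      then obtain j where "j \<in> I" "B' \<in> C j" "{x, y} \<subseteq> B'" by blast
      then show "B' = B"
        using uniq[OF iB(1,2) _ _ iB(3)] xy(3) by blast
    qed
  next
    show "finite X" "card X = v" using X by auto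
  next
    fix B assume "B \<in> (\<Union>i\<in>I. C i)"
    then show "B \<subseteq> X" "card B = 3" using sub card3 by auto
  qed
  moreover have "resolvable v X (\<Union>i\<in>I. C i)"
  proof -
    have ne: "C i \<noteq> {}" if "i \<in> I" for i
      using cardC[OF that] v by auto
    have dC: "C i \<inter> C j = {}" if ij: "i \<in> I" "j \<in> I" "i \<noteq> j" for i j
    proof (rule ccontr)
      assume "C i \<inter> C j \<noteq> {}"
      then obtain B where B: "B \<in> C i" "B \<in> C j" by blast
      obtain x y z where "B = {x, y, z}" "x \<noteq> y"
        using card3[OF ij(1) B(1)] by (auto simp: card_3_iff)
      then have "{x, y} \<subseteq> B" "x \<noteq> y" by auto
      then show False
        using uniq[OF ij(1) B(1) ij(2) B(2)] ij(3) by blast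
    qed
    have "inj_on C I"
      using dC ne by (metis Int_absorb inj_onI)
    then have "card (C ` I) = (v - 1) div 2"
      using v by (simp add: card_image)
    moreover have "partition_on (\<Union>i\<in>I. C i) (C ` I)"
      unfolding partition_on_def disjoint_def
    proof (intro conjI)
      show "{} \<notin> C ` I"
        using ne by (metis imageE)
    qed (use dC in auto)
    ultimately show ?thesis
      unfolding resolvable_def parallel_class_def using part by (intro exI[of _ "C ` I"]) auto
  qed
  ultimately show ?thesis
    by (simp add: kirkman_triple_system_def)
qed

lemma steiner_triple_system_card:
  assumes "steiner_triple_system v X \<B>"
  shows "3 * card \<B> = v choose 2"
proof -
  define pairs where "pairs B = {S. S \<subseteq> B \<and> card S = 2}" for B :: "'a set"
  have X: "finite X" "card X = v" and B: "\<And>B. B \<in> \<B> \<Longrightarrow> B \<subseteq> X \<and> card B = 3"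
    and uniq: "\<And>x y. x \<in> X \<Longrightarrow> y \<in> X \<Longrightarrow> x \<noteq> y \<Longrightarrow> \<exists>!B. B \<in> \<B> \<and> {x, y} \<subseteq> B"
    using assms by (simp_all add: steiner_triple_system_def)
  have finB: "finite B" if "B \<in> \<B>" for B
    using B[OF that] X finite_subset by blast
  have fin: "finite \<B>"
    using X B by (intro finite_subset[of \<B> "Pow X"]) auto
  have pairs3: "card (pairs B) = 3" if "B \<in> \<B>" for B
    using n_subsets[OF finB[OF that], of 2] B[OF that]
    by (simp add: pairs_def choose_two)
  have UN: "(\<Union>B\<in>\<B>. pairs B) = pairs X"
  proof (intro equalityI subsetI)
    fix S assume "S \<in> pairs X"
    then obtain x y where S: "S = {x, y}" "x \<noteq> y" "x \<in> X" "y \<in> X"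
      by (auto simp: pairs_def card_2_iff)
    then obtain B where "B \<in> \<B>" "{x, y} \<subseteq> B"
      using uniq[of x y] by blast
    then show "S \<in> (\<Union>B\<in>\<B>. pairs B)"
      using S by (auto simp: pairs_def)
  next
    fix S assume "S \<in> (\<Union>B\<in>\<B>. pairs B)"
    then obtain B' where "B' \<in> \<B>" "S \<in> pairs B'" by auto
    then show "S \<in> pairs X"
      using B[of B'] by (auto simp: pairs_def)
  qed
  have "v choose 2 = card (\<Union>B\<in>\<B>. pairs B)"
    using X n_subsets[of X 2] UN by (simp add: pairs_def)
  also have "\<dots> = (\<Sum>B\<in>\<B>. card (pairs B))"
  proof (rule card_UN_disjoint[OF fin])
    show "\<forall>B\<in>\<B>. finite (pairs B)"
      using finB by (simp add: pairs_def)
    show "\<forall>B\<in>\<B>. \<forall>B'\<in>\<B>. B \<noteq> B' \<longrightarrow> pairs B \<inter> pairs B' = {}"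
    proof (intro ballI impI, rule ccontr)
      fix B B' assume BB: "B \<in> \<B>" "B' \<in> \<B>" "B \<noteq> B'" "pairs B \<inter> pairs B' \<noteq> {}"
      then obtain x y where "x \<noteq> y" "{x, y} \<subseteq> B" "{x, y} \<subseteq> B'"
        by (auto simp: pairs_def card_2_iff)
      then show False
        using uniq[of x y] B BB by blast
    qed
  qed
  also have "\<dots> = 3 * card \<B>"
    using pairs3 by simp
  finally show ?thesis by simp
qed

text \<open>The v - 2 systems have v(v - 1)/6 blocks each, in total the number of triples, so a
  covering of the triples is already disjoint. Being nonempty, disjoint systems are also
  distinct.\<close>

lemma large_set_KTS_I:
  fixes S :: "'j \<Rightarrow> 'a set set"
  assumes X: "finite X" "card X = v" and v: "v \<ge> 3" and J: "finite J" "card J = v - 2"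
    and kts: "\<And>j. j \<in> J \<Longrightarrow> kirkman_triple_system v X (S j)"
    and cover: "\<And>T. T \<subseteq> X \<Longrightarrow> card T = 3 \<Longrightarrow> \<exists>j\<in>J. T \<in> S j"
  shows "large_set_KTS v X (S ` J)"
proof -
  have sts: "steiner_triple_system v X (S j)" if "j \<in> J" for j
    using kts[OF that] by (simp add: kirkman_triple_system_def)
  have cardS: "3 * card (S j) = v choose 2" if "j \<in> J" for j
    using steiner_triple_system_card[OF sts[OF that]] .
  have SX: "B \<subseteq> X \<and> card B = 3" if "j \<in> J" "B \<in> S j" for j B
    using sts[OF that(1)] that(2) by (simp add: steiner_triple_system_def)
  have finS: "finite (S j)" if "j \<in> J" for j
  proof (rule finite_subset)
    show "S j \<subseteq> Pow X"
      using SX[OF that] by blast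
  qed (simp add: X)
  have UN: "(\<Union>j\<in>J. S j) = {T. T \<subseteq> X \<and> card T = 3}"
  proof (intro equalityI subsetI)
    fix T assume "T \<in> (\<Union>j\<in>J. S j)"
    then show "T \<in> {T. T \<subseteq> X \<and> card T = 3}"
      using SX by auto
  next
    fix T assume "T \<in> {T. T \<subseteq> X \<and> card T = 3}"
    then show "T \<in> (\<Union>j\<in>J. S j)"
      using cover[of T] by auto
  qed
  have "3 * (\<Sum>j\<in>J. card (S j)) = (\<Sum>j\<in>J. v choose 2)"
    by (simp add: sum_distrib_left cardS)
  also have "\<dots> = (v - 2) * (v choose 2)"
    using J by simp
  \<comment> \<open>Both sides equal v times the binomial coefficient of v - 1 over 2.\<close>
  also have "\<dots> = 3 * (v choose 3)"
    using binomial_absorb_comp binomial_absorption eval_nat_numeral(3) by presburger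
  also have "v choose 3 = card (\<Union>j\<in>J. S j)"
    using n_subsets[OF X(1), of 3] X(2) UN by simp
  finally have le: "(\<Sum>j\<in>J. card (S j)) \<le> card (\<Union>j\<in>J. S j)" by simp
  have disj: "S i \<inter> S j = {}" if "i \<in> J" "j \<in> J" "i \<noteq> j" for i j
    using disjoint_if_sum_card_le_card_UN[OF J(1) finS le that] .
  have ne: "S j \<noteq> {}" if "j \<in> J" for j
    using cardS[OF that] v zero_less_binomial[of 2 v] by auto
  have "inj_on S J"
    using disj ne by (metis Int_absorb inj_onI)
  then have "card (S ` J) = v - 2"
    using J by (simp add: card_image)
  moreover have "pairwise disjnt (S ` J)"
    using disj by (auto simp: pairwise_def disjnt_def)
  ultimately show ?thesis
    using kts sts by (auto simp: large_set_KTS_def large_set_STS_def)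
qed

section \<open>Points and blocks\<close>

lemma partition_on_image_inj_on:
  assumes "partition_on A P" "inj_on f A"
  shows "partition_on (f ` A) ((`) f ` P)"
proof -
  have "{} \<notin> (`) f ` P"
    using assms(1) by (auto simp: partition_on_def)
  then show ?thesis
    using partition_on_inj_image[OF assms] by simp
qed

lemma partition_on_Un_disjoint:
  assumes "partition_on A P" "partition_on B Q" "A \<inter> B = {}"
  shows "partition_on (A \<union> B) (P \<union> Q)"
proof (rule partition_onI)
  show "\<Union>(P \<union> Q) = A \<union> B"
    using assms(1,2) by (simp add: partition_on_def)
  have PA: "p \<subseteq> A" if "p \<in> P" for p
    using assms(1) that by (auto simp: partition_on_def)
  have QB: "q \<subseteq> B" if "q \<in> Q" for q
    using assms(2) that by (auto simp: partition_on_def)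
  have PP: "disjnt p q" if "p \<in> P" "q \<in> P" "p \<noteq> q" for p q
    using assms(1) that by (auto simp: partition_on_def disjoint_def disjnt_def)
  have QQ: "disjnt p q" if "p \<in> Q" "q \<in> Q" "p \<noteq> q" for p q
    using assms(2) that by (auto simp: partition_on_def disjoint_def disjnt_def)
  have PQ: "disjnt p q \<and> disjnt q p" if "p \<in> P" "q \<in> Q" for p q
    using PA[OF that(1)] QB[OF that(2)] assms(3) unfolding disjnt_def by blast
  show "disjnt p q" if "p \<in> P \<union> Q" "q \<in> P \<union> Q" "p \<noteq> q" for p q
    using that PP QQ PQ by blast
qed (use assms(1,2) in \<open>auto simp: partition_on_def\<close>)

text \<open>Three distinct points are never all infinite, as \<open>bool\<close> has only two
  elements. The rule serves both the large and the small point set.\<close>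

lemma sum_bool_triple_cases:
  assumes "card T = 3"
    and 3: "\<And>u v w. u \<noteq> v \<Longrightarrow> u \<noteq> w \<Longrightarrow> v \<noteq> w \<Longrightarrow> P {Inl u, Inl v, Inl w}"
    and 2: "\<And>u v b. u \<noteq> v \<Longrightarrow> P {Inr b, Inl u, Inl v}"
    and 1: "\<And>b c u. b \<noteq> c \<Longrightarrow> P {Inr b, Inr c, Inl u}"
  shows "P (T :: ('a + bool) set)"
proof -
  obtain p q r where T: "T = {p, q, r}" and d: "p \<noteq> q" "p \<noteq> r" "q \<noteq> r"
    using assms(1) by (auto simp: card_3_iff)
  show ?thesis
  proof (cases p; cases q; cases r)
    fix u v w assume "p = Inl u" "q = Inl v" "r = Inl w"
    then show ?thesis
      using 3[of u v w] d T by simp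
  next
    fix u v w assume "p = Inl u" "q = Inl v" "r = Inr w"
    then show ?thesis
      using 2[of u v w] d T by (simp add: insert_commute)
  next
    fix u v w assume "p = Inl u" "q = Inr v" "r = Inl w"
    then show ?thesis
      using 2[of u w v] d T by (simp add: insert_commute)
  next
    fix u v w assume "p = Inl u" "q = Inr v" "r = Inr w"
    then show ?thesis
      using 1[of v w u] d T by (simp add: insert_commute)
  next
    fix u v w assume "p = Inr u" "q = Inl v" "r = Inl w"
    then show ?thesis
      using 2[of v w u] d T by (simp add: insert_commute)
  next
    fix u v w assume "p = Inr u" "q = Inl v" "r = Inr w"
    then show ?thesis
      using 1[of u w v] d T by (simp add: insert_commute)
  next
    fix u v w assume "p = Inr u" "q = Inr v" "r = Inl w"
    then show ?thesis
      using 1[of u v w] d T by (simp add: insert_commute)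
  next
    fix u v w assume "p = Inr u" "q = Inr v" "r = Inr w"
    then show ?thesis
      using d by auto
  qed
qed

section \<open>Arithmetic modulo 7: squares, quotients and zero-sum triples\<close>

lemma all_7: "(\<forall>x::7. P x) \<longleftrightarrow> P 0 \<and> P 1 \<and> P 2 \<and> P 3 \<and> P 4 \<and> P 5 \<and> P 6"
proof -
  have "x \<in> {0, 1, 2, 3, 4, 5, 6}" for x :: 7
  proof (cases x)
    case (of_int z)
    then have "z \<in> {0, 1, 2, 3, 4, 5, 6}" by auto
    then show ?thesis using of_int by auto
  qed
  then have "P x" if "P 0 \<and> P 1 \<and> P 2 \<and> P 3 \<and> P 4 \<and> P 5 \<and> P 6" for x
    using that by (metis emptyE insertE)
  then show ?thesis by blast
qed

type_synonym 'a point = "(7 \<times> 'a) + bool"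

abbreviation Pt :: "7 \<Rightarrow> 'a \<Rightarrow> 'a point" where "Pt x h \<equiv> Inl (x, h)"
abbreviation Infty :: "bool \<Rightarrow> 'a point" where "Infty \<equiv> Inr"

text \<open>The nonzero squares are the powers of 2, whereas -1 and -2 are nonsquares. Hence
  multiplying by squares preserves \<open>QR\<close> and \<open>NR\<close>, while negation and x ->
  -2x interchange them.\<close>

definition QR :: "7 set" where "QR = {1, 2, 4}"
definition NR :: "7 set" where "NR = {3, 5, 6}"

lemma QR_NR: "x \<noteq> 0 \<Longrightarrow> x \<in> QR \<or> x \<in> NR"
proof -
  have "\<forall>x. x \<noteq> 0 \<longrightarrow> x \<in> QR \<or> x \<in> NR"
    unfolding all_7 by (simp add: QR_def NR_def)
  then show "x \<noteq> 0 \<Longrightarrow> x \<in> QR \<or> x \<in> NR" by blast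
qed

lemma QR_quotient:
  assumes "x \<in> QR \<and> y \<in> QR \<or> x \<in> NR \<and> y \<in> NR"
  obtains m where "m \<in> QR" "y = m * x"
proof -
  have "\<forall>x y. x \<in> QR \<and> y \<in> QR \<or> x \<in> NR \<and> y \<in> NR \<longrightarrow> (\<exists>m\<in>QR. y = m * x)"
    unfolding all_7 by (simp add: QR_def NR_def)
  then show thesis using assms that by blast
qed

lemma QR_mult: "m \<in> QR \<Longrightarrow> m * x \<in> QR \<longleftrightarrow> x \<in> QR"
proof -
  have "\<forall>m x. m \<in> QR \<longrightarrow> (m * x \<in> QR \<longleftrightarrow> x \<in> QR)"
    unfolding all_7 by (simp add: QR_def)
  then show "m \<in> QR \<Longrightarrow> m * x \<in> QR \<longleftrightarrow> x \<in> QR" by blast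
qed

lemma QR_cube: "m \<in> QR \<Longrightarrow> m * (m * m) = 1"
proof -
  have "\<forall>m. m \<in> QR \<longrightarrow> m * (m * m) = 1"
    unfolding all_7 by (simp add: QR_def)
  then show "m \<in> QR \<Longrightarrow> m * (m * m) = 1" by blast
qed

text \<open>The quotient y/x is one of -1, -2, 3 = 1/(-2), 2 and 4 = 1/2. It decides which type of
  block joins the fibres over x and y.\<close>

lemma distinct_residues_cases:
  fixes x y :: 7
  assumes "x \<noteq> y" "x \<noteq> 0" "y \<noteq> 0"
  shows "y = - x \<or> y = - 2 * x \<or> x = - 2 * y \<or> (\<exists>k\<in>{1, 6}. y = 2 * x \<and> x \<in> {k, 2 * k, 4 * k} \<or> x = 2 * y \<and> y \<in> {k, 2 * k, 4 * k})"
proof -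
  have "\<forall>x y::7. x \<noteq> y \<longrightarrow> x \<noteq> 0 \<longrightarrow> y \<noteq> 0 \<longrightarrow> y = - x \<or> y = - 2 * x \<or> x = - 2 * y \<or>
    (\<exists>k\<in>{1, 6}. y = 2 * x \<and> x \<in> {k, 2 * k, 4 * k} \<or> x = 2 * y \<and> y \<in> {k, 2 * k, 4 * k})"
    unfolding all_7 by simp
  then show ?thesis using assms by blast
qed

text \<open>Distinct nonzero residues with sum 0 are either the three squares or the three
  nonsquares, as 1 + 2 + 4 = 7 and 3 + 5 + 6 = 14. In the triples (0, d, -d) the square can be named
  \<open>d\<close> because -1 is a nonsquare.\<close>

lemma zero_sum_cases:
  fixes x y z :: 7
  assumes "x + y + z = 0"
  shows "x = 0 \<and> y = 0 \<and> z = 0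
    \<or> x \<noteq> 0 \<and> y = x \<and> z = - 2 * x \<or> x \<noteq> 0 \<and> z = x \<and> y = - 2 * x \<or> y \<noteq> 0 \<and> z = y \<and> x = - 2 * y
    \<or> (\<exists>d\<in>QR. x = 0 \<and> y = d \<and> z = - d \<or> x = 0 \<and> z = d \<and> y = - d \<or> y = 0 \<and> x = d \<and> z = - d
        \<or> y = 0 \<and> z = d \<and> x = - d \<or> z = 0 \<and> x = d \<and> y = - d \<or> z = 0 \<and> y = d \<and> x = - d)
    \<or> (\<exists>k\<in>{1, 6}. x = k \<and> y = 2 * k \<and> z = 4 * k \<or> x = k \<and> z = 2 * k \<and> y = 4 * k \<or> y = k \<and> x = 2 * k \<and> z = 4 * k
        \<or> y = k \<and> z = 2 * k \<and> x = 4 * k \<or> z = k \<and> x = 2 * k \<and> y = 4 * k \<or> z = k \<and> y = 2 * k \<and> x = 4 * k)"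
proof -
  have z: "z = - x - y"
    using assms by (metis add.commute add_diff_cancel_left' diff_0 diff_diff_eq2 diff_minus_eq_add minus_diff_eq)
  \<comment> \<open>Quantifying \<open>z\<close> over a singleton leaves 49 cases for
    \<open>all_7\<close>.\<close>
  have H: "\<forall>x y::7. \<forall>z\<in>{- x - y}. x = 0 \<and> y = 0 \<and> z = 0
    \<or> x \<noteq> 0 \<and> y = x \<and> z = - 2 * x \<or> x \<noteq> 0 \<and> z = x \<and> y = - 2 * x \<or> y \<noteq> 0 \<and> z = y \<and> x = - 2 * y
    \<or> (\<exists>d\<in>QR. x = 0 \<and> y = d \<and> z = - d \<or> x = 0 \<and> z = d \<and> y = - d \<or> y = 0 \<and> x = d \<and> z = - d
        \<or> y = 0 \<and> z = d \<and> x = - d \<or> z = 0 \<and> x = d \<and> y = - d \<or> z = 0 \<and> y = d \<and> x = - d)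
    \<or> (\<exists>k\<in>{1, 6}. x = k \<and> y = 2 * k \<and> z = 4 * k \<or> x = k \<and> z = 2 * k \<and> y = 4 * k \<or> y = k \<and> x = 2 * k \<and> z = 4 * k
        \<or> y = k \<and> z = 2 * k \<and> x = 4 * k \<or> z = k \<and> x = 2 * k \<and> y = 4 * k \<or> z = k \<and> y = 2 * k \<and> x = 4 * k)"
    unfolding all_7 by (simp add: QR_def)
  show ?thesis
    by (rule H[rule_format]) (simp add: z)
qed

text \<open>The two residues differ by 3x, so x is 5 = 1/3 times their difference. Exchanging
  \<open>y\<close> and \<open>z\<close> negates x, and -1 is a nonsquare, so exactly one orientation
  has the prescribed character.\<close>

lemma difference_orientation:
  fixes y z :: 7
  assumes "y \<noteq> z"
  obtains a x where "x \<noteq> 0" "(x \<in> QR) = b" "y = x + a \<and> z = - 2 * x + a \<or> z = x + a \<and> y = - 2 * x + a"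
proof -
  have "\<forall>b. \<forall>y z::7. y \<noteq> z \<longrightarrow> (\<exists>x\<in>{5 * (y - z), 5 * (z - y)}. x \<noteq> 0 \<and> (x \<in> QR) = b \<and>
    (y = x + (y - x) \<and> z = - 2 * x + (y - x) \<or> z = x + (z - x) \<and> y = - 2 * x + (z - x)))"
    unfolding all_7 by (simp add: QR_def all_bool_eq)
  then show thesis using assms that by blast
qed

section \<open>Block types and the maps acting on them\<close>

definition Z_block :: "7 \<Rightarrow> 'a \<Rightarrow> 'a \<Rightarrow> 'a::comm_ring_1 point set" where
  "Z_block d e h = {Pt 0 h, Pt d (h + e), Pt (- d) (h - e)}"

text \<open>\<open>h\<close> is the midpoint of the other two H-coordinates. For
  \<open>e = 0\<close> two points coincide; \<open>I_block\<close> takes over there.\<close>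

definition D_block :: "7 \<Rightarrow> 'a \<Rightarrow> 'a \<Rightarrow> 'a::comm_ring_1 point set" where
  "D_block x e h = {Pt x (h + e), Pt x (h - e), Pt (- 2 * x) h}"

text \<open>Since -2 is a nonsquare, a point outside the fibre over 0 meets one infinite point as
  \<open>Pt x h\<close> and the other one as \<open>Pt (- 2 * x) h\<close>.\<close>

definition I_block :: "7 \<Rightarrow> 'a \<Rightarrow> 'a::comm_ring_1 point set" where
  "I_block x h = {Infty (x \<in> QR), Pt x h, Pt (- 2 * x) h}"

text \<open>The differences around the cycle k, 2k, 4k, k are e, \<omega> e and \<omega>^2 e; they
  add up to 0 when \<omega> is a root of 1 + X + X^2.\<close>

definition Q_block :: "'a \<Rightarrow> 7 \<Rightarrow> 'a \<Rightarrow> 'a \<Rightarrow> 'a::comm_ring_1 point set" where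
  "Q_block \<omega> k e h = {Pt k h, Pt (2 * k) (h + e), Pt (4 * k) (h + e + \<omega> * e)}"

definition emb :: "'a + bool \<Rightarrow> 'a point" where
  "emb = map_sum (Pair 0) id"

definition dil :: "7 \<Rightarrow> 'a \<Rightarrow> 'a::comm_ring_1 point \<Rightarrow> 'a point" where
  "dil m t = map_sum (\<lambda>(x, h). (m * x, h + t)) id"

text \<open>
  The weights \<open>mu\<close> make the coefficient of \<open>j\<close> a unit in the linear relation of each type of block
  of \<open>twist a j\<close>; see \<open>mu_units\<close> below.
\<close>

definition mu :: "7 \<Rightarrow> 'a::comm_ring_1" where
  "mu x = (if x \<in> {0, 1} then 1 else if x \<in> {5, 6} then 3 else if x = 3 then 4 else 0)"

definition twist :: "7 \<Rightarrow> 'a \<Rightarrow> 'a::comm_ring_1 point \<Rightarrow> 'a point" where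
  "twist a j = map_sum (\<lambda>(x, h). (x + a, h + mu x * j)) id"

lemma emb_simps [simp]: "emb (Inl h) = Pt 0 h" "emb (Inr b) = Infty b"
  by (simp_all add: emb_def)

lemma dil_simps [simp]: "dil m t (Pt x h) = Pt (m * x) (h + t)" "dil m t (Infty b) = Infty b"
  by (simp_all add: dil_def)

lemma twist_simps [simp]: "twist a j (Pt x h) = Pt (x + a) (h + mu x * j)" "twist a j (Infty b) = Infty b"
  by (simp_all add: twist_def)

lemma inj_emb: "inj emb"
  by (auto simp: emb_def inj_def map_sum_def split: sum.splits)

lemma inj_dil:
  assumes "m \<in> QR"
  shows "inj (dil m t)"
proof (rule injI)
  fix p q assume eq: "dil m t p = dil m t q"
  have "x = y" if "m * x = m * y" for x y :: 7
  proof -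
    have "m * m * (m * x) = m * m * (m * y)" using that by simp
    then show "x = y" using QR_cube[OF assms] by (simp add: mult.assoc[symmetric])
  qed
  then show "p = q"
    using eq by (cases p; cases q) auto
qed

lemma inj_twist: "inj (twist a j)"
proof (rule injI)
  fix p q assume "twist a j p = twist a j q"
  then show "p = q" by (cases p; cases q) auto
qed

definition fibres :: "7 \<Rightarrow> 'a point set" where
  "fibres k = {Pt x h |x h. x \<in> {k, 2 * k, 4 * k}}"

lemma UNIV_point: "(UNIV :: 'a point set) = range emb \<union> fibres 1 \<union> fibres 6"
proof -
  have *: "\<forall>x::7. x = 0 \<or> x \<in> {1, 2 * 1, 4 * 1} \<or> x \<in> {6, 2 * 6, 4 * 6}"
    unfolding all_7 by simp
  have "p \<in> range emb \<union> fibres 1 \<union> fibres 6" for p :: "'a point"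
  proof (cases p)
    case (Inl a)
    then obtain x h where p: "p = Pt x h" by (cases a) auto
    consider "x = 0" | "x \<in> {1, 2 * 1, 4 * 1}" | "x \<in> {6, 2 * 6, 4 * 6}"
      using * by blast
    then show ?thesis
    proof cases
      case 1
      then have "p = emb (Inl h)" using p by simp
      then show ?thesis by blast
    qed (use p in \<open>auto simp: fibres_def\<close>)
  next
    case (Inr b)
    then have "p = emb (Inr b)" by simp
    then show ?thesis by blast
  qed
  then show ?thesis by blast
qed

lemma fibres_disjoint: "fibres 1 \<inter> fibres 6 = {}" "range emb \<inter> (fibres 1 \<union> fibres 6) = {}"
  by (auto simp: fibres_def emb_def map_sum_def split: sum.splits)

lemma residues_distinct:
  fixes k :: 7
  assumes "k \<in> {1, 6}"
  shows "k \<noteq> 0" "2 * k \<noteq> 0" "4 * k \<noteq> 0" "k \<noteq> 2 * k" "k \<noteq> 4 * k" "2 * k \<noteq> 4 * k"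
  using assms by auto

text \<open>For fixed \<open>e\<close>, the translates pass once through every point of the three
  fibres. One parameter for \<open>k = 1\<close> and one for \<open>k = 6\<close> thus complete a
  class of the small system.\<close>

lemma partition_Q_blocks:
  assumes k: "k \<in> {1, 6}"
  shows "partition_on (fibres k) (range (Q_block \<omega> k e))"
proof (rule partition_onI)
  show "\<Union>(range (Q_block \<omega> k e)) = fibres k"
  proof (intro equalityI subsetI)
    fix p :: "'a point" assume "p \<in> fibres k"
    then obtain x h where p: "p = Pt x h" "x \<in> {k, 2 * k, 4 * k}"
      by (auto simp: fibres_def)
    then have "p \<in> Q_block \<omega> k e h \<or> p \<in> Q_block \<omega> k e (h - e) \<or> p \<in> Q_block \<omega> k e (h - e - \<omega> * e)"
      by (auto simp: Q_block_def)
    then show "p \<in> \<Union>(range (Q_block \<omega> k e))" by blast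
  qed (auto simp: Q_block_def fibres_def)
  have "h = h'" if "p \<in> Q_block \<omega> k e h" "p \<in> Q_block \<omega> k e h'" for p h h'
    using that k by (auto simp: Q_block_def)
  then show "disjnt p q" if "p \<in> range (Q_block \<omega> k e)" "q \<in> range (Q_block \<omega> k e)" "p \<noteq> q" for p q
    using that unfolding disjnt_def by blast
qed (auto simp: Q_block_def)

lemma card_Q_block:
  assumes k: "k \<in> {1, 6}"
  shows "card (Q_block \<omega> k e h) = 3"
  using residues_distinct[OF k] by (simp add: Q_block_def)

lemma dil_Z_block: "dil m t ` Z_block d e h = Z_block (m * d) e (h + t)"
  by (simp add: Z_block_def algebra_simps)

lemma dil_D_block: "dil m t ` D_block x e h = D_block (m * x) e (h + t)"
  by (simp add: D_block_def algebra_simps)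

lemma dil_I_block:
  assumes "m \<in> QR"
  shows "dil m t ` I_block x h = I_block (m * x) (h + t)"
  using QR_mult[OF assms, of x] by (simp add: I_block_def algebra_simps)

lemma dil_Q_block: "dil m t ` Q_block \<omega> k e h = Q_block \<omega> (m * k) e (h + t)"
  by (simp add: Q_block_def algebra_simps)

text \<open>Reading the cycle from its second point multiplies the parameter by \<omega>. A block
  with parameter e in \<open>P0\<close> therefore also accounts for \<omega> e and \<omega>^2
  e.\<close>

lemma Q_block_rotate:
  assumes "1 + \<omega> + \<omega> * \<omega> = 0"
  shows "Q_block \<omega> k e h = Q_block \<omega> (2 * k) (\<omega> * e) (h + e)"
proof -
  have "h + e + \<omega> * e + \<omega> * (\<omega> * e) = h + e * (1 + \<omega> + \<omega> * \<omega>)"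
    by (simp add: algebra_simps)
  then have "h + e + \<omega> * e + \<omega> * (\<omega> * e) = h"
    using assms by simp
  moreover have "4 * (2 * k) = k" for k :: 7
  proof -
    have "4 * (2 * k) = 8 * k" by simp
    also have "(8::7) = 1" by simp
    finally show ?thesis by simp
  qed
  ultimately show ?thesis
    by (auto simp: Q_block_def)
qed

section \<open>The Kirkman triple system and its images\<close>

text \<open>
  The classes \<open>A i\<close> resolve a Kirkman triple system on \<open>H\<close> and two infinite points whose translates
  form a large set. \<open>A i\<close> will be completed by the blocks \<open>Q_block \<omega> 1 (\<alpha> i) h\<close> and
  \<open>Q_block \<omega> 6 (\<beta> i) h\<close>; the remaining parallel classes are developed from \<open>P0\<close>.
\<close>

locale kirkman_data =
  fixes \<omega> half third :: "'a::{finite, comm_ring_1}"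
    and I :: "'i set" and A :: "'i \<Rightarrow> ('a + bool) set set" and \<alpha> \<beta> :: "'i \<Rightarrow> 'a"
    and P0 :: "'a point set set"
  assumes omega: "1 + \<omega> + \<omega> * \<omega> = 0" and half: "2 * half = 1" and third: "3 * third = 1"
    and I: "finite I" "CARD('a) + 1 = 2 * card I"
    and A_partition: "\<And>i. i \<in> I \<Longrightarrow> partition_on UNIV (A i)"
    and A_card: "\<And>i B. i \<in> I \<Longrightarrow> B \<in> A i \<Longrightarrow> card B = 3"
    and A_pairs: "\<And>x y. x \<noteq> y \<Longrightarrow> \<exists>i\<in>I. \<exists>B\<in>A i. {x, y} \<subseteq> B"
    and A_triples: "\<And>T. card T = 3 \<Longrightarrow> \<exists>i\<in>I. \<exists>B\<in>A i. \<exists>t. T = map_sum (\<lambda>h. h + t) id ` B"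
    and P0_partition: "partition_on UNIV P0" and P0_card: "\<And>B. B \<in> P0 \<Longrightarrow> card B = 3"
    and P0_Z: "\<And>e. \<exists>d\<in>QR. \<exists>h. Z_block d e h \<in> P0"
    and P0_D: "\<And>e. e \<noteq> 0 \<Longrightarrow> (\<exists>x\<in>QR. \<exists>h. D_block x e h \<in> P0) \<and> (\<exists>x\<in>NR. \<exists>h. D_block x e h \<in> P0)"
    and P0_I: "(\<exists>x\<in>QR. \<exists>h. I_block x h \<in> P0) \<and> (\<exists>x\<in>NR. \<exists>h. I_block x h \<in> P0)"
    and P0_Q: "\<And>e. e \<in> \<alpha> ` I \<or> (\<exists>k\<in>QR. \<exists>h. Q_block \<omega> k e h \<in> P0)"
    and P0_Q': "\<And>e. e \<in> \<beta> ` I \<or> (\<exists>k\<in>NR. \<exists>h. Q_block \<omega> k e h \<in> P0)"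
begin

definition classes :: "('i + 7 \<times> 'a) set" where
  "classes = Inl ` I \<union> Inr ` (QR \<times> UNIV)"

fun cls :: "'i + 7 \<times> 'a \<Rightarrow> 'a point set set" where
  "cls (Inl i) = (`) emb ` A i \<union> range (Q_block \<omega> 1 (\<alpha> i)) \<union> range (Q_block \<omega> 6 (\<beta> i))"
| "cls (Inr (m, t)) = (`) (dil m t) ` P0"

definition blocks :: "'a point set set" where
  "blocks = (\<Union>c\<in>classes. cls c)"

lemma finite_classes: "finite classes"
  using I by (simp add: classes_def)

text \<open>This is the count (v - 1)/2 for v = 7n + 2: (n + 1)/2 completed small classes and 3n
  images of \<open>P0\<close>.\<close>

lemma card_classes: "7 * CARD('a) + 2 = 2 * card classes + 1"
proof -
  have "card classes = card (Inl ` I :: ('i + 7 \<times> 'a) set) + card (Inr ` (QR \<times> UNIV) :: ('i + 7 \<times> 'a) set)"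
    unfolding classes_def using I by (intro card_Un_disjoint) auto
  also have "\<dots> = card I + 3 * CARD('a)"
    by (simp add: card_image card_cartesian_product QR_def)
  finally show ?thesis using I by simp
qed

lemma cls_partition:
  assumes "c \<in> classes"
  shows "partition_on UNIV (cls c)"
proof -
  consider (A) i where "c = Inl i" "i \<in> I" | (P) m t where "c = Inr (m, t)" "m \<in> QR"
    using assms by (auto simp: classes_def)
  then show ?thesis
  proof cases
    case A
    have "partition_on (range emb) ((`) emb ` A i)"
      using partition_on_image_inj_on[OF A_partition[OF A(2)] inj_emb] .
    then have "partition_on (range emb \<union> fibres 1 \<union> fibres 6) (cls c)"
      unfolding A(1) cls.simps using fibres_disjoint
      by (intro partition_on_Un_disjoint partition_Q_blocks) auto
    then show ?thesis by (simp add: UNIV_point)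
  next
    case P
    have "range (dil m t) = UNIV"
      using finite_UNIV_inj_surj[OF finite inj_dil[OF P(2)]] .
    then show ?thesis
      using partition_on_image_inj_on[OF P0_partition inj_dil[OF P(2), of t]] P(1) by simp
  qed
qed

lemma cls_card:
  assumes "c \<in> classes" "B \<in> cls c"
  shows "card B = 3"
proof -
  consider (A) i where "c = Inl i" "i \<in> I" | (P) m t where "c = Inr (m, t)" "m \<in> QR"
    using assms by (auto simp: classes_def)
  then show ?thesis
  proof cases
    case A
    then consider B' where "B = emb ` B'" "B' \<in> A i" | k e h where "k \<in> {1, 6}" "B = Q_block \<omega> k e h"
      using assms(2) by fastforce
    then show ?thesis
    proof cases
      case 1
      then show ?thesis
        using A_card[OF A(2)] by (simp add: card_image[OF inj_on_subset[OF inj_emb subset_UNIV]])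
    qed (simp add: card_Q_block)
  next
    case P
    then obtain B' where "B = dil m t ` B'" "B' \<in> P0"
      using assms(2) by auto
    then show ?thesis
      using P0_card by (simp add: card_image[OF inj_on_subset[OF inj_dil[OF P(2)] subset_UNIV]])
  qed
qed

lemma A_in_blocks: "i \<in> I \<Longrightarrow> B \<in> A i \<Longrightarrow> emb ` B \<in> blocks"
  by (force simp: blocks_def classes_def)

lemma dil_in_blocks:
  assumes "m \<in> QR" "B \<in> P0"
  shows "dil m t ` B \<in> blocks"
proof -
  have "Inr (m, t) \<in> classes" "dil m t ` B \<in> cls (Inr (m, t))"
    using assms by (auto simp: classes_def)
  then show ?thesis unfolding blocks_def by blast
qed

text \<open>The maps \<open>dil m t\<close> with square \<open>m\<close> are transitive on the
  blocks of this type with given \<open>e\<close>, so one such block in \<open>P0\<close> is enough.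
  The next lemmas argue alike, separately for squares and nonsquares.\<close>

lemma Z_in_blocks:
  assumes "d \<in> QR"
  shows "Z_block d e h \<in> blocks"
proof -
  obtain d0 h0 where 0: "d0 \<in> QR" "Z_block d0 e h0 \<in> P0" using P0_Z by blast
  obtain m where "m \<in> QR" "d = m * d0" using QR_quotient assms 0(1) by metis
  then show ?thesis
    using dil_in_blocks[OF _ 0(2), of m "h - h0"] by (simp add: dil_Z_block)
qed

lemma D_in_blocks:
  assumes "x \<noteq> 0" "e \<noteq> 0"
  shows "D_block x e h \<in> blocks"
proof -
  obtain x0 h0 where 0: "x0 \<in> QR \<and> x \<in> QR \<or> x0 \<in> NR \<and> x \<in> NR" "D_block x0 e h0 \<in> P0"
    using P0_D[OF assms(2)] QR_NR[OF assms(1)] by blast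
  obtain m where "m \<in> QR" "x = m * x0" using QR_quotient[OF 0(1)] by metis
  then show ?thesis
    using dil_in_blocks[OF _ 0(2), of m "h - h0"] by (simp add: dil_D_block)
qed

lemma I_in_blocks:
  assumes "x \<noteq> 0"
  shows "I_block x h \<in> blocks"
proof -
  obtain x0 h0 where 0: "x0 \<in> QR \<and> x \<in> QR \<or> x0 \<in> NR \<and> x \<in> NR" "I_block x0 h0 \<in> P0"
    using P0_I QR_NR[OF assms(1)] by blast
  obtain m where "m \<in> QR" "x = m * x0" using QR_quotient[OF 0(1)] by metis
  then show ?thesis
    using dil_in_blocks[OF _ 0(2), of m "h - h0"] by (simp add: dil_I_block)
qed

text \<open>Parameters among the values of \<alpha> or \<beta> come from the completed small
  classes, all others from \<open>P0\<close>.\<close>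

lemma Q_in_blocks:
  assumes "k \<in> {1, 6}"
  shows "Q_block \<omega> k e h \<in> blocks"
proof -
  have "k = 1 \<and> e \<in> \<alpha> ` I \<or> k = 6 \<and> e \<in> \<beta> ` I \<or>
    (\<exists>k0 h0. (k0 \<in> QR \<and> k \<in> QR \<or> k0 \<in> NR \<and> k \<in> NR) \<and> Q_block \<omega> k0 e h0 \<in> P0)"
    using assms P0_Q[of e] P0_Q'[of e] by (auto simp: QR_def NR_def)
  then consider i where "i \<in> I" "k = 1 \<and> e = \<alpha> i \<or> k = 6 \<and> e = \<beta> i"
    | k0 h0 where "k0 \<in> QR \<and> k \<in> QR \<or> k0 \<in> NR \<and> k \<in> NR" "Q_block \<omega> k0 e h0 \<in> P0"
    by blast
  then show ?thesis
  proof cases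
    case 1
    then have "Inl i \<in> classes" "Q_block \<omega> k e h \<in> cls (Inl i)"
      by (auto simp: classes_def)
    then show ?thesis unfolding blocks_def by blast
  next
    case 2
    obtain m where "m \<in> QR" "k = m * k0" using QR_quotient[OF 2(1)] by metis
    then show ?thesis
      using dil_in_blocks[OF _ 2(2), of m "h - h0"] by (simp add: dil_Q_block)
  qed
qed

end

section \<open>Every pair of points lies in a block\<close>

context kirkman_data
begin

definition paired :: "'a point \<Rightarrow> 'a point \<Rightarrow> bool" where
  "paired p q \<longleftrightarrow> (\<exists>B\<in>blocks. {p, q} \<subseteq> B)"

lemma paired_commute: "paired p q \<longleftrightarrow> paired q p"
  by (auto simp: paired_def)

lemma pairedI: "B \<in> blocks \<Longrightarrow> p \<in> B \<Longrightarrow> q \<in> B \<Longrightarrow> paired p q"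
  by (auto simp: paired_def)

lemma paired_emb:
  assumes "x \<noteq> y"
  shows "paired (emb x) (emb y)"
proof -
  obtain i B where iB: "i \<in> I" "B \<in> A i" "{x, y} \<subseteq> B"
    using A_pairs[OF assms] by blast
  show ?thesis
    by (rule pairedI[OF A_in_blocks[OF iB(1,2)]]) (use iB(3) in auto)
qed

lemma half_add: "half * x + half * x = x"
proof -
  have "half * x + half * x = 2 * half * x" by (simp add: algebra_simps)
  then show ?thesis by (simp add: half)
qed

lemma paired_zero:
  assumes "x \<noteq> 0"
  shows "paired (Pt 0 h) (Pt x h')"
  using QR_NR[OF assms]
proof
  assume "x \<in> QR"
  then show ?thesis
    by (intro pairedI[OF Z_in_blocks[of x "h' - h" h]]) (auto simp: Z_block_def)
next
  assume "x \<in> NR"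
  then have "- x \<in> QR" by (auto simp: QR_def NR_def)
  then show ?thesis
    by (intro pairedI[OF Z_in_blocks[of "- x" "h - h'" h]]) (auto simp: Z_block_def)
qed

lemma paired_fibre:
  assumes "x \<noteq> 0" "h \<noteq> h'"
  shows "paired (Pt x h) (Pt x h')"
proof -
  let ?e = "half * (h - h')" and ?m = "half * (h + h')"
  have 1: "?m + ?e = h" and 2: "?m - ?e = h'"
    using half_add[of h] half_add[of h'] by (simp_all add: algebra_simps)
  have "?e \<noteq> 0"
  proof
    assume "?e = 0"
    then have "h - h' = 0" using half_add[of "h - h'"] by simp
    then show False using assms by simp
  qed
  then show ?thesis
    by (intro pairedI[OF D_in_blocks[OF assms(1), of ?e ?m]]) (simp_all add: D_block_def 1 2)
qed

lemma paired_double: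
  shows "x \<noteq> 0 \<Longrightarrow> paired (Pt x h) (Pt (- 2 * x) h')"
proof (cases "h = h'")
  case True
  assume "x \<noteq> 0"
  then show ?thesis
    using True by (intro pairedI[OF I_in_blocks[of x h]]) (auto simp: I_block_def)
next
  case False
  assume "x \<noteq> 0"
  then show ?thesis
    using False by (intro pairedI[OF D_in_blocks[of x "h - h'" h']]) (auto simp: D_block_def)
qed

lemma omega_cube: "\<omega> * (\<omega> * \<omega>) = 1"
proof -
  have "\<omega> * (\<omega> * \<omega>) - 1 = (\<omega> - 1) * (1 + \<omega> + \<omega> * \<omega>)"
    by (simp add: algebra_simps)
  then show ?thesis by (simp add: omega)
qed

text \<open>The difference from x to 2x is e, \<omega> e or \<omega>^2 e according to the position
  of x in the cycle. Dividing by the power of \<omega>, with \<omega>^3 = 1, gives the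
  parameter.\<close>

lemma paired_Q:
  assumes k: "k \<in> {1, 6}" and x: "x \<in> {k, 2 * k, 4 * k}"
  shows "paired (Pt x h) (Pt (2 * x) h')"
proof -
  consider "x = k" | "x = 2 * k" | "x = 4 * k" using x by blast
  then show ?thesis
  proof cases
    case 1
    then show ?thesis
      by (intro pairedI[OF Q_in_blocks[OF k, of "h' - h" h]]) (auto simp: Q_block_def)
  next
    case 2
    let ?e = "\<omega> * \<omega> * (h' - h)"
    have "h - ?e + ?e + \<omega> * ?e - h' = (h' - h) * (\<omega> * (\<omega> * \<omega>) - 1)"
      by (simp add: algebra_simps)
    then have "h - ?e + ?e + \<omega> * ?e = h'"
      by (simp add: omega_cube)
    then show ?thesis
      using 2 by (intro pairedI[OF Q_in_blocks[OF k, of ?e "h - ?e"]]) (auto simp: Q_block_def)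
  next
    case 3
    let ?e = "\<omega> * (h' - h)"
    have "h' + ?e + \<omega> * ?e - h = (h' - h) * (1 + \<omega> + \<omega> * \<omega>)"
      by (simp add: algebra_simps)
    then have "h' + ?e + \<omega> * ?e = h"
      by (simp add: omega)
    moreover have "2 * x = k" using 3 k by auto
    ultimately show ?thesis
      using 3 by (intro pairedI[OF Q_in_blocks[OF k, of ?e h']]) (auto simp: Q_block_def)
  qed
qed

lemma paired_Infty:
  assumes "x \<noteq> 0"
  shows "paired (Infty b) (Pt x h)"
proof (cases "b = (x \<in> QR)")
  case True
  then show ?thesis
    by (intro pairedI[OF I_in_blocks[OF assms, of h]]) (auto simp: I_block_def)
next
  case False
  \<comment> \<open>The witness is y = 3x: modulo 7, -2 * 3 = 1, and 3 is a nonsquare.\<close>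
  have "\<forall>x. x \<noteq> 0 \<longrightarrow> (\<exists>y. y \<noteq> 0 \<and> x = - 2 * y \<and> (y \<in> QR) \<noteq> (x \<in> QR))"
  proof -
    have "\<forall>x. x \<noteq> 0 \<longrightarrow> 3 * x \<noteq> 0 \<and> x = - 2 * (3 * x) \<and> (3 * x \<in> QR) \<noteq> (x \<in> QR)"
      unfolding all_7 by (simp add: QR_def)
    then show ?thesis by blast
  qed
  then obtain y where y: "y \<noteq> 0" "x = - 2 * y" "(y \<in> QR) \<noteq> (x \<in> QR)"
    using assms by blast
  then have "b = (y \<in> QR)" using False by blast
  then show ?thesis
    using y(2) by (intro pairedI[OF I_in_blocks[OF y(1), of h]]) (auto simp: I_block_def)
qed

lemma pairs_covered:
  assumes "p \<noteq> q"
  shows "paired p q"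
proof -
  have PP: "paired (Pt x h) (Pt y h')" if ne: "(x, h) \<noteq> (y, h')" for x y h h'
  proof -
    consider "x = 0" "y = 0" | "x = 0" "y \<noteq> 0" | "x \<noteq> 0" "y = 0" | "x \<noteq> 0" "x = y" | "x \<noteq> 0" "y \<noteq> 0" "x \<noteq> y"
      by blast
    then show ?thesis
    proof cases
      case 1
      then show ?thesis using paired_emb[of "Inl h" "Inl h'"] ne by simp
    next
      case 2
      then show ?thesis using paired_zero by simp
    next
      case 3
      then show ?thesis using paired_zero paired_commute by metis
    next
      case 4
      then show ?thesis using paired_fibre ne by simp
    next
      case 5
      from distinct_residues_cases[OF 5(3,1,2)] show ?thesis
      proof (elim disjE bexE conjE)
        assume y: "y = - x"
        from QR_NR[OF 5(1)] show ?thesis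
        proof
          assume "x \<in> QR"
          then show ?thesis
            using y by (intro pairedI[OF Z_in_blocks[of x "half * (h - h')" "half * (h + h')"]])
              (use half_add[of h] half_add[of h'] in \<open>auto simp: Z_block_def algebra_simps\<close>)
        next
          assume "x \<in> NR"
          then have "y \<in> QR" using y by (auto simp: QR_def NR_def)
          then show ?thesis
            using y by (intro pairedI[OF Z_in_blocks[of y "half * (h' - h)" "half * (h + h')"]])
              (use half_add[of h] half_add[of h'] in \<open>auto simp: Z_block_def algebra_simps\<close>)
        qed
      next
        assume "y = - 2 * x" then show ?thesis using paired_double[OF 5(1)] by blast
      next
        assume "x = - 2 * y" then show ?thesis using paired_double[OF 5(2)] paired_commute by blast
      next
        fix k :: 7 assume "k \<in> {1, 6}" "y = 2 * x" "x \<in> {k, 2 * k, 4 * k}"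
        then show ?thesis using paired_Q by blast
      next
        fix k :: 7 assume "k \<in> {1, 6}" "x = 2 * y" "y \<in> {k, 2 * k, 4 * k}"
        then show ?thesis using paired_Q paired_commute by blast
      qed
    qed
  qed
  have IP: "paired (Infty b) (Pt x h)" for b x h
  proof (cases "x = 0")
    case True
    then show ?thesis using paired_emb[of "Inr b" "Inl h"] by simp
  qed (use paired_Infty in blast)
  show ?thesis
  proof (cases p; cases q)
    fix a c assume "p = Inl a" "q = Inl c"
    then show ?thesis using PP assms by (cases a; cases c) auto
  next
    fix a c assume "p = Inl a" "q = Inr c"
    then show ?thesis using IP paired_commute by (cases a) blast
  next
    fix a c assume "p = Inr a" "q = Inl c"
    then show ?thesis using IP by (cases c) blast
  next
    fix a c assume "p = Inr a" "q = Inr c"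
    then show ?thesis using paired_emb[of "Inr a" "Inr c"] assms by simp
  qed
qed

end

section \<open>Every triple of points lies in an image of the system\<close>

context kirkman_data
begin

definition reached :: "'a point set \<Rightarrow> bool" where
  "reached T \<longleftrightarrow> (\<exists>a j. \<exists>B\<in>blocks. T = twist a j ` B)"

lemma reachedI: "B \<in> blocks \<Longrightarrow> T = twist a j ` B \<Longrightarrow> reached T"
  by (auto simp: reached_def)

text \<open>Twists do not compose in general, since the second one reads its weights in the shifted
  fibres. With outer parameter 0 they do, which allows a triple to be moved to convenient residues
  first.\<close>

lemma twist_shift: "twist a 0 (twist b j p) = twist (b + a) j p"
  by (cases p) (auto simp: algebra_simps)

lemma reached_shift:
  assumes "reached T"
  shows "reached (twist a 0 ` T)"
proof -
  obtain b j B where "B \<in> blocks" "T = twist b j ` B"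
    using assms by (auto simp: reached_def)
  then show ?thesis
    by (intro reachedI[of B _ "b + a" j]) (simp_all add: image_image twist_shift)
qed

lemma reached_emb:
  assumes "card T = 3"
  shows "reached (emb ` T)"
proof -
  obtain i B t where B: "i \<in> I" "B \<in> A i" "T = map_sum (\<lambda>h. h + t) id ` B"
    using A_triples[OF assms] by blast
  \<comment> \<open>Because \<open>mu 0 = 1\<close>, twisting acts on the fibre over 0 as the plain
    translation that occurs in \<open>A_triples\<close>.\<close>
  have "emb (map_sum (\<lambda>h. h + t) id x) = twist 0 t (emb x)" for x
    by (cases x) (auto simp: mu_def)
  then have "emb ` T = twist 0 t ` emb ` B"
    unfolding B(3) by (simp add: image_image)
  then show ?thesis
    by (rule reachedI[OF A_in_blocks[OF B(1,2)]])
qed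

lemma double_cancel:
  fixes x y :: 'a
  shows "2 * x = 2 * y \<Longrightarrow> x = y"
proof -
  have half_2: "half * (2 * z) = z" for z
  proof -
    have "half * (2 * z) = 2 * half * z" by (simp only: mult_ac)
    then show ?thesis by (simp add: half)
  qed
  show "2 * x = 2 * y \<Longrightarrow> x = y" by (metis half_2)
qed

text \<open>Up to a factor 2 for \<open>D_block\<close>, these are the coefficients of
  \<open>j\<close> in the change that \<open>twist 0 j\<close> makes to the relation of
  \<open>D_block\<close> and \<open>I_block\<close>, of \<open>Z_block\<close>, and of
  \<open>Q_block\<close>.\<close>

lemma mu_units:
  shows "x \<noteq> 0 \<Longrightarrow> \<exists>u. (mu x - mu (- 2 * x)) * u = (1 :: 'a)"
    and "x \<in> QR \<Longrightarrow> \<exists>u. (mu x + mu (- x) - 2) * u = (1 :: 'a)"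
    and "k \<in> {1, 6} \<Longrightarrow> \<exists>u. (mu (4 * k) - mu (2 * k) - \<omega> * (mu (2 * k) - mu k)) * u = (1 :: 'a)"
proof -
  have i4: "4 * (half * half) = 1"
  proof -
    have "4 * (half * half) = (2 * half) * (2 * half)" by (simp add: algebra_simps)
    then show ?thesis by (simp add: half)
  qed
  have "\<forall>x. x \<noteq> 0 \<longrightarrow> mu x - mu (- 2 * x) \<in> {- 2, 3, - 3, - 4 :: 'a}"
    unfolding all_7 by (simp add: mu_def)
  moreover have "\<exists>u. y * u = (1 :: 'a)" if "y \<in> {- 2, 3, - 3, - 4}" for y
    using that
    by (auto intro: exI[of _ "- half"] exI[of _ "- (half * half)"] exI[of _ "third"] exI[of _ "- third"] simp: half third i4)
  ultimately show "x \<noteq> 0 \<Longrightarrow> \<exists>u. (mu x - mu (- 2 * x)) * u = (1 :: 'a)"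
    by blast
  have "\<forall>x. x \<in> QR \<longrightarrow> mu x + mu (- x) - 2 \<in> {1, 2 :: 'a}"
    unfolding all_7 by (simp add: mu_def QR_def)
  moreover have "\<exists>u. y * u = (1 :: 'a)" if "y \<in> {1, 2}" for y
    using that half by auto
  ultimately show "x \<in> QR \<Longrightarrow> \<exists>u. (mu x + mu (- x) - 2) * u = (1 :: 'a)"
    by blast
  \<comment> \<open>The coefficient is \<omega> for \<open>k = 1\<close> and 1 for
    \<open>k = 6\<close>, with inverses \<omega>^2 and 1.\<close>
  show "k \<in> {1, 6} \<Longrightarrow> \<exists>u. (mu (4 * k) - mu (2 * k) - \<omega> * (mu (2 * k) - mu k)) * u = (1 :: 'a)"
    using omega_cube by (auto simp: mu_def intro: exI[of _ 1] exI[of _ "\<omega> * \<omega>"])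
qed

text \<open>\<open>S\<close> is the defect of the triple in the midpoint relation, to which twisting
  contributes 2 (m - n) j. Once \<open>j\<close> absorbs it, undoing the twist leaves a genuine
  \<open>D_block\<close>, whose \<open>e\<close> is nonzero because h1 and h2 differ.\<close>

lemma reached_D:
  assumes x: "x \<noteq> 0" and h12: "h1 \<noteq> h2"
  shows "reached {Pt x h1, Pt x h2, Pt (- 2 * x) h3}"
proof -
  define m n where "m = (mu x :: 'a)" and "n = (mu (- 2 * x) :: 'a)"
  obtain u where u: "(m - n) * u = 1"
    using mu_units(1)[OF x] m_def n_def by blast
  define S where "S = h1 + h2 - 2 * h3"
  define j where "j = half * (u * S)"
  define h where "h = h3 - n * j"
  define e where "e = half * (h1 - h2)"
  have e2: "2 * e = h1 - h2"
    unfolding e_def mult_2 by (rule half_add)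
  have "2 * ((m - n) * j) = (2 * half) * (((m - n) * u) * S)"
    unfolding j_def by (simp only: mult_ac)
  then have j2: "2 * ((m - n) * j) = S"
    by (simp only: half u mult_1)
  have "2 * (h + e + m * j) = 2 * h3 + 2 * ((m - n) * j) + 2 * e"
    unfolding h_def by (simp only: algebra_simps)
  also have "\<dots> = 2 * h1"
    unfolding j2 e2 S_def by simp
  finally have 1: "h + e + m * j = h1"
    by (rule double_cancel)
  have "2 * (h - e + m * j) = 2 * h3 + 2 * ((m - n) * j) - 2 * e"
    unfolding h_def by (simp only: algebra_simps)
  also have "\<dots> = 2 * h2"
    unfolding j2 e2 S_def by simp
  finally have 2: "h - e + m * j = h2"
    by (rule double_cancel)
  have "e \<noteq> 0"
    using e2 h12 by auto
  have 3: "h + n * j = h3"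
    by (simp add: h_def)
  show ?thesis
    by (rule reachedI[OF D_in_blocks[OF x \<open>e \<noteq> 0\<close>, of h], of _ 0 j])
      (use 1 2 3 in \<open>simp add: D_block_def m_def n_def\<close>)
qed

lemma reached_I:
  assumes x: "x \<noteq> 0"
  shows "reached {Infty (x \<in> QR), Pt x h1, Pt (- 2 * x) h2}"
proof -
  obtain u :: 'a where u: "(mu x - mu (- 2 * x)) * u = 1"
    using mu_units(1)[OF x] by blast
  define j where "j = u * (h1 - h2)"
  define h where "h = h1 - mu x * j"
  have j: "(mu x - mu (- 2 * x)) * j = h1 - h2"
    using u by (simp add: j_def mult.assoc[symmetric])
  have "h + mu (- 2 * x) * j = h1 - (mu x - mu (- 2 * x)) * j"
    by (simp add: h_def algebra_simps)
  then have 2: "h + mu (- 2 * x) * j = h2"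
    unfolding j by simp
  have 1: "h + mu x * j = h1"
    by (simp add: h_def)
  show ?thesis
    by (rule reachedI[OF I_in_blocks[OF x, of h], of _ 0 j]) (use 1 2 in \<open>simp add: I_block_def\<close>)
qed

lemma reached_Z:
  assumes d: "d \<in> QR"
  shows "reached {Pt 0 h1, Pt d h2, Pt (- d) h3}"
proof -
  obtain u :: 'a where u: "(mu d + mu (- d) - 2) * u = 1"
    using mu_units(2)[OF d] by blast
  define j where "j = u * (h2 + h3 - 2 * h1)"
  \<comment> \<open>The weight of the fibre over 0 is 1, whence \<open>j\<close> without a
    factor.\<close>
  define h where "h = h1 - j"
  define e where "e = h2 - h - mu d * j"
  have j: "(mu d + mu (- d) - 2) * j = h2 + h3 - 2 * h1"
    using u by (simp add: j_def mult.assoc[symmetric])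
  have "h - e + mu (- d) * j = 2 * h1 - h2 + (mu d + mu (- d) - 2) * j"
    by (simp add: h_def e_def algebra_simps)
  then have 3: "h - e + mu (- d) * j = h3"
    unfolding j by simp
  have 1: "h + mu 0 * j = h1" and 2: "h + e + mu d * j = h2"
    by (simp_all add: h_def e_def mu_def)
  show ?thesis
    by (rule reachedI[OF Z_in_blocks[OF d, of e h], of _ 0 j]) (use 1 2 3 in \<open>simp add: Z_block_def\<close>)
qed

lemma reached_Q:
  assumes k: "k \<in> {1, 6}"
  shows "reached {Pt k h1, Pt (2 * k) h2, Pt (4 * k) h3}"
proof -
  let ?c = "mu (4 * k) - mu (2 * k) - \<omega> * (mu (2 * k) - mu k)"
  obtain u :: 'a where u: "?c * u = 1"
    using mu_units(3)[OF k] by blast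
  define j where "j = u * (h3 - h2 - \<omega> * (h2 - h1))"
  define h where "h = h1 - mu k * j"
  define e where "e = h2 - mu (2 * k) * j - h"
  have j: "?c * j = h3 - h2 - \<omega> * (h2 - h1)"
    using u by (simp add: j_def mult.assoc[symmetric])
  have "h + e + \<omega> * e + mu (4 * k) * j = h2 + \<omega> * (h2 - h1) + ?c * j"
    by (simp add: h_def e_def algebra_simps)
  then have 3: "h + e + \<omega> * e + mu (4 * k) * j = h3"
    unfolding j by simp
  have 1: "h + mu k * j = h1" and 2: "h + e + mu (2 * k) * j = h2"
    by (simp_all add: h_def e_def)
  show ?thesis
    by (rule reachedI[OF Q_in_blocks[OF k, of e h], of _ 0 j]) (use 1 2 3 in \<open>simp add: Q_block_def\<close>)
qed

lemma reached_zero_sum: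
  assumes sum: "y1 + y2 + y3 = 0"
    and distinct: "(y1, h1) \<noteq> (y2, h2)" "(y1, h1) \<noteq> (y3, h3)" "(y2, h2) \<noteq> (y3, h3)"
  shows "reached {Pt y1 h1, Pt y2 h2, Pt y3 h3}"
  using zero_sum_cases[OF sum]
proof (elim disjE bexE conjE)
  assume y: "y1 = 0" "y2 = 0" "y3 = 0"
  then have "card {Inl h1, Inl h2, Inl h3 :: 'a + bool} = 3"
    using distinct by simp
  from reached_emb[OF this] show ?thesis
    using y by simp
next
  assume y: "y1 \<noteq> 0" "y2 = y1" "y3 = - 2 * y1"
  then have "h1 \<noteq> h2"
    using distinct by auto
  from reached_D[OF y(1) this, of h3] show ?thesis
    using y by (simp add: insert_commute)
next
  assume y: "y1 \<noteq> 0" "y3 = y1" "y2 = - 2 * y1"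
  then have "h1 \<noteq> h3"
    using distinct by auto
  from reached_D[OF y(1) this, of h2] show ?thesis
    using y by (simp add: insert_commute)
next
  assume y: "y2 \<noteq> 0" "y3 = y2" "y1 = - 2 * y2"
  then have "h2 \<noteq> h3"
    using distinct by auto
  from reached_D[OF y(1) this, of h1] show ?thesis
    using y by (simp add: insert_commute)
next
  fix d assume "d \<in> QR" "y1 = 0" "y2 = d" "y3 = - d"
  then show ?thesis
    using reached_Z[of d h1 h2 h3] by (simp add: insert_commute)
next
  fix d assume "d \<in> QR" "y1 = 0" "y3 = d" "y2 = - d"
  then show ?thesis
    using reached_Z[of d h1 h3 h2] by (simp add: insert_commute)
next
  fix d assume "d \<in> QR" "y2 = 0" "y1 = d" "y3 = - d"
  then show ?thesis
    using reached_Z[of d h2 h1 h3] by (simp add: insert_commute)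
next
  fix d assume "d \<in> QR" "y2 = 0" "y3 = d" "y1 = - d"
  then show ?thesis
    using reached_Z[of d h2 h3 h1] by (simp add: insert_commute)
next
  fix d assume "d \<in> QR" "y3 = 0" "y1 = d" "y2 = - d"
  then show ?thesis
    using reached_Z[of d h3 h1 h2] by (simp add: insert_commute)
next
  fix d assume "d \<in> QR" "y3 = 0" "y2 = d" "y1 = - d"
  then show ?thesis
    using reached_Z[of d h3 h2 h1] by (simp add: insert_commute)
next
  fix k :: 7 assume "k \<in> {1, 6}" "y1 = k" "y2 = 2 * k" "y3 = 4 * k"
  then show ?thesis
    using reached_Q[of k h1 h2 h3] by (simp only: insert_commute)
next
  fix k :: 7 assume "k \<in> {1, 6}" "y1 = k" "y3 = 2 * k" "y2 = 4 * k"
  then show ?thesis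
    using reached_Q[of k h1 h3 h2] by (simp only: insert_commute)
next
  fix k :: 7 assume "k \<in> {1, 6}" "y2 = k" "y1 = 2 * k" "y3 = 4 * k"
  then show ?thesis
    using reached_Q[of k h2 h1 h3] by (simp only: insert_commute)
next
  fix k :: 7 assume "k \<in> {1, 6}" "y2 = k" "y3 = 2 * k" "y1 = 4 * k"
  then show ?thesis
    using reached_Q[of k h2 h3 h1] by (simp only: insert_commute)
next
  fix k :: 7 assume "k \<in> {1, 6}" "y3 = k" "y1 = 2 * k" "y2 = 4 * k"
  then show ?thesis
    using reached_Q[of k h3 h1 h2] by (simp only: insert_commute)
next
  fix k :: 7 assume "k \<in> {1, 6}" "y3 = k" "y2 = 2 * k" "y1 = 4 * k"
  then show ?thesis
    using reached_Q[of k h3 h2 h1] by (simp only: insert_commute)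
qed

lemma reached_Pt_Pt_Pt:
  assumes "(x1, h1) \<noteq> (x2, h2)" "(x1, h1) \<noteq> (x3, h3)" "(x2, h2) \<noteq> (x3, h3)"
  shows "reached {Pt x1 h1, Pt x2 h2, Pt x3 h3}"
proof -
  \<comment> \<open>5 is the inverse of 3 modulo 7, so subtracting \<open>a\<close> from each of the
    three residues makes their sum 0.\<close>
  define a where "a = 5 * (x1 + x2 + x3)"
  have "\<forall>s::7. 5 * s + 5 * s + 5 * s = s"
    unfolding all_7 by simp
  then have "a + a + a = x1 + x2 + x3"
    unfolding a_def by blast
  moreover have "(x1 - a) + (x2 - a) + (x3 - a) = (x1 + x2 + x3) - (a + a + a)"
    by (simp only: algebra_simps)
  ultimately have "(x1 - a) + (x2 - a) + (x3 - a) = 0"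
    by simp
  then have "reached {Pt (x1 - a) h1, Pt (x2 - a) h2, Pt (x3 - a) h3}"
    using assms by (intro reached_zero_sum) auto
  from reached_shift[OF this, of a] show ?thesis by simp
qed

lemma reached_Infty_Pt_Pt:
  assumes "(y, h) \<noteq> (z, h')"
  shows "reached {Infty b, Pt y h, Pt z h'}"
proof (cases "y = z")
  case True
  then have "card {Inr b, Inl h, Inl h' :: 'a + bool} = 3"
    using assms by simp
  from reached_shift[OF reached_emb[OF this], of y] show ?thesis
    using True by simp
next
  case False
  then obtain a x where x: "x \<noteq> 0" "(x \<in> QR) = b"
    and yz: "y = x + a \<and> z = - 2 * x + a \<or> z = x + a \<and> y = - 2 * x + a"
    by (rule difference_orientation[of y z b])
  from yz show ?thesis
  proof
    assume "y = x + a \<and> z = - 2 * x + a"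
    then show ?thesis
      using reached_shift[OF reached_I[OF x(1), of h h'], of a] x(2) by simp
  next
    assume "z = x + a \<and> y = - 2 * x + a"
    then show ?thesis
      using reached_shift[OF reached_I[OF x(1), of h' h], of a] x(2) by (simp add: insert_commute)
  qed
qed

lemma reached_Infty_Infty_Pt:
  assumes "b \<noteq> c"
  shows "reached {Infty b, Infty c, Pt x h}"
proof -
  have "card {Inr b, Inr c, Inl h :: 'a + bool} = 3"
    using assms by simp
  from reached_shift[OF reached_emb[OF this], of x] show ?thesis
    by simp
qed

lemma triples_reached:
  assumes "card T = 3"
  shows "reached T"
  using assms
proof (rule sum_bool_triple_cases)
  show "reached {Inl u, Inl v, Inl w}" if "u \<noteq> v" "u \<noteq> w" "v \<noteq> w" for u v w
    using reached_Pt_Pt_Pt[of "fst u" "snd u" "fst v" "snd v" "fst w" "snd w"] that by simp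
  show "reached {Inr b, Inl u, Inl v}" if "u \<noteq> v" for u v b
    using reached_Infty_Pt_Pt[of "fst u" "snd u" "fst v" "snd v" b] that by simp
  show "reached {Inr b, Inr c, Inl u}" if "b \<noteq> c" for b c u
    using reached_Infty_Infty_Pt[of b c "fst u" "snd u"] that by simp
qed

theorem large_set_exists: "\<exists>(X :: nat set) \<L>. large_set_KTS (7 * CARD('a) + 2) X \<L>"
proof -
  obtain f :: "'a point \<Rightarrow> nat" where f: "inj f"
    using finite_imp_inj_to_nat_seg[OF finite[of "UNIV :: 'a point set"]] by blast
  \<comment> \<open>Each twist permutes the points, so all the systems transported along
    \<open>f\<close> have the same point set \<open>range f\<close>.\<close>
  define \<phi> where "\<phi> c = f \<circ> twist (fst c) (snd c)" for c
  have inj: "inj (\<phi> c)" for c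
    unfolding \<phi>_def using f inj_twist by (rule inj_compose)
  have range: "range (\<phi> c) = range f" for c
  proof -
    have "range (twist (fst c) (snd c)) = (UNIV :: 'a point set)"
      using finite_UNIV_inj_surj[OF finite inj_twist] .
    then show ?thesis by (metis \<phi>_def image_comp)
  qed
  have card_f: "card (range f) = 7 * CARD('a) + 2"
    using f by (simp add: card_image)
  \<comment> \<open>The index \<open>c\<close> runs over all pairs of a residue modulo 7 and an
    element of H, which makes 7n = v - 2 systems.\<close>
  have "large_set_KTS (7 * CARD('a) + 2) (range f) ((\<lambda>c. \<Union>k\<in>classes. (`) (\<phi> c) ` cls k) ` UNIV)"
  proof (rule large_set_KTS_I)
    show "kirkman_triple_system (7 * CARD('a) + 2) (range f) (\<Union>k\<in>classes. (`) (\<phi> c) ` cls k)" for c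
    proof (rule kirkman_triple_systemI)
      show "partition_on (range f) ((`) (\<phi> c) ` cls k)" if "k \<in> classes" for k
        using partition_on_image_inj_on[OF cls_partition[OF that] inj] by (simp add: range)
      show "card B = 3" if "k \<in> classes" "B \<in> (`) (\<phi> c) ` cls k" for k B
        using that cls_card by (auto simp: card_image[OF inj_on_subset[OF inj subset_UNIV]])
      show "\<exists>k\<in>classes. \<exists>B\<in>(`) (\<phi> c) ` cls k. {x, y} \<subseteq> B" if xy: "x \<in> range f" "y \<in> range f" "x \<noteq> y" for x y
      proof -
        have "x \<in> range (\<phi> c)" "y \<in> range (\<phi> c)"
          using xy(1,2) by (simp_all only: range)
        then obtain p q where pq: "x = \<phi> c p" "y = \<phi> c q"
          by (elim rangeE)
        have "p \<noteq> q" using pq xy(3) by auto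
        then have "paired p q" by (rule pairs_covered)
        then obtain k B where "k \<in> classes" "B \<in> cls k" "{p, q} \<subseteq> B"
          unfolding paired_def blocks_def by blast
        then have "\<phi> c ` B \<in> (`) (\<phi> c) ` cls k" "{x, y} \<subseteq> \<phi> c ` B"
          using pq by auto
        then show ?thesis using \<open>k \<in> classes\<close> by blast
      qed
    qed (use card_classes in \<open>simp_all add: finite_classes card_f\<close>)
    show "\<exists>c\<in>UNIV. T \<in> (\<Union>k\<in>classes. (`) (\<phi> c) ` cls k)" if T: "T \<subseteq> range f" "card T = 3" for T
    proof -
      obtain T' where T': "T = f ` T'"
        using T(1) by (meson subset_imageE)
      then have "card T' = 3"
        using T(2) by (simp add: card_image[OF inj_on_subset[OF f subset_UNIV]])
      from triples_reached[OF this] obtain a j B where B: "B \<in> blocks" "T' = twist a j ` B"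
        unfolding reached_def by blast
      from B(1) obtain k where k: "k \<in> classes" "B \<in> cls k"
        unfolding blocks_def by blast
      have "T = \<phi> (a, j) ` B"
        by (simp add: T' B(2) \<phi>_def image_comp)
      then have "T \<in> (`) (\<phi> (a, j)) ` cls k" using k(2) by blast
      then show ?thesis using k(1) by blast
    qed
  qed (simp_all add: card_f)
  then show ?thesis by blast
qed

end

section \<open>Integer certificates\<close>

text \<open>With |X|/3 sets of at most 3 points, a covering of X can afford neither an overlap nor a
  smaller set.\<close>

lemma partition_on_if_covering:
  fixes bs :: "'p::finite set list"
  assumes len: "3 * length bs = CARD('p)" and card: "\<And>b. b \<in> set bs \<Longrightarrow> card b \<le> 3"
    and cover: "\<Union>(set bs) = UNIV"
  shows "partition_on UNIV (set bs)" "\<And>b. b \<in> set bs \<Longrightarrow> card b = 3"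
proof -
  let ?J = "{..<length bs}"
  have UN: "(\<Union>i\<in>?J. bs ! i) = UNIV"
    using cover by (auto simp: set_conv_nth)
  have le: "(\<Sum>i\<in>?J. card (bs ! i)) \<le> (\<Sum>i\<in>?J. 3)"
    using card by (intro sum_mono) auto
  then have "(\<Sum>i\<in>?J. card (bs ! i)) \<le> card (\<Union>i\<in>?J. bs ! i)"
    unfolding UN using len by simp
  from disjoint_if_sum_card_le_card_UN[OF _ _ this]
  have disj: "bs ! i \<inter> bs ! j = {}" if "i < length bs" "j < length bs" "i \<noteq> j" for i j
    using that by simp
  have "CARD('p) \<le> (\<Sum>i\<in>?J. card (bs ! i))"
    using card_UN_le[of ?J "\<lambda>i. bs ! i"] UN by simp
  then have eq: "(\<Sum>i\<in>?J. card (bs ! i)) = (\<Sum>i\<in>?J. 3)"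
    using le len by simp
  have c3: "card (bs ! i) = 3" if "i < length bs" for i
  proof (rule ccontr)
    assume "card (bs ! i) \<noteq> 3"
    then have "card (bs ! i) < 3"
      using card[of "bs ! i"] that by simp
    then have "(\<Sum>i\<in>?J. card (bs ! i)) < (\<Sum>i\<in>?J. 3)"
      using that card by (intro sum_strict_mono_ex1) auto
    then show False using eq by simp
  qed
  show c3': "card b = 3" if "b \<in> set bs" for b
    using that c3 by (auto simp: in_set_conv_nth)
  show "partition_on UNIV (set bs)"
  proof (rule partition_onI)
    show "disjnt p q" if pq: "p \<in> set bs" "q \<in> set bs" "p \<noteq> q" for p q
    proof -
      obtain i where i: "i < length bs" "p = bs ! i"
        using pq(1) by (auto simp: in_set_conv_nth)
      obtain j where j: "j < length bs" "q = bs ! j"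
        using pq(2) by (auto simp: in_set_conv_nth)
      have "i \<noteq> j" using i j pq(3) by auto
      then show ?thesis
        using disj i j by (simp add: disjnt_def)
    qed
    show "{} \<notin> set bs"
      using c3' by force
  qed (use cover in auto)
qed

lemma set_if_sort_eq: "sort xs = ys \<Longrightarrow> set xs = set ys"
  by (metis set_sort)

text \<open>
  Elements of \<open>H\<close> are coded by \<open>{0..<n}\<close>; the points \<open>Pt x h\<close>, \<open>Infty True\<close> and \<open>Infty False\<close> have the
  codes \<open>x * n + h\<close>, \<open>7 * n\<close> and \<open>7 * n + 1\<close>, and in the Kirkman triple system on \<open>H\<close> and two infinite
  points the latter have the codes \<open>n\<close> and \<open>n + 1\<close>.
\<close>

type_synonym triple = "int \<times> int \<times> int"

fun points :: "triple \<Rightarrow> int list" where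
  "points (a, b, c) = [a, b, c]"

text \<open>The input lists the parameters of a block, namely \<open>e\<close>, a residue and
  \<open>h\<close>; the output lists its points. \<open>7 - d\<close> represents -d, and
  \<open>5 * x mod 7\<close> below represents -2x.\<close>

fun Z_code :: "int \<Rightarrow> (int \<Rightarrow> int \<Rightarrow> int) \<Rightarrow> (int \<Rightarrow> int \<Rightarrow> int) \<Rightarrow> triple \<Rightarrow> triple" where
  "Z_code n ad sb (e, d, h) = (h, d * n + ad h e, (7 - d) * n + sb h e)"

fun D_code :: "int \<Rightarrow> (int \<Rightarrow> int \<Rightarrow> int) \<Rightarrow> (int \<Rightarrow> int \<Rightarrow> int) \<Rightarrow> triple \<Rightarrow> triple" where
  "D_code n ad sb (e, x, h) = (x * n + ad h e, x * n + sb h e, (5 * x mod 7) * n + h)"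

fun I_code :: "int \<Rightarrow> triple \<Rightarrow> triple" where
  "I_code n (e, x, h) = (if x \<in> {1, 2, 4} then 7 * n else 7 * n + 1, x * n + h, (5 * x mod 7) * n + h)"

fun Q_code :: "int \<Rightarrow> (int \<Rightarrow> int \<Rightarrow> int) \<Rightarrow> (int \<Rightarrow> int) \<Rightarrow> triple \<Rightarrow> triple" where
  "Q_code n ad om (e, k, h) = (k * n + h, (2 * k mod 7) * n + ad h e, (4 * k mod 7) * n + ad (ad h e) (om e))"

definition in_range :: "int \<Rightarrow> int list \<Rightarrow> triple \<Rightarrow> bool" where
  "in_range n ks = (\<lambda>(e, k, h). 0 \<le> e \<and> e < n \<and> k \<in> set ks \<and> 0 \<le> h \<and> h < n)"

fun neighbours :: "int \<Rightarrow> triple \<Rightarrow> int list" where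
  "neighbours r (a, b, c) = (if a = r then [b, c] else if b = r then [a, c] else if c = r then [a, b] else [])"

fun difference_codes :: "int \<Rightarrow> (int \<Rightarrow> int \<Rightarrow> int) \<Rightarrow> int list \<Rightarrow> int list" where
  "difference_codes n sb [x, y] = (if x < n \<and> y < n then [sb x y, sb y x] else [])"
| "difference_codes n sb _ = []"

text \<open>Moving \<open>a\<close> to 0 by a translation turns the triple into {0, b - a, c - a};
  if the second entry is \<open>r\<close>, the third is the key. All six orders are tried
  below.\<close>

definition key_codes :: "(int \<Rightarrow> int \<Rightarrow> int) \<Rightarrow> int \<Rightarrow> int \<Rightarrow> int \<Rightarrow> int \<Rightarrow> int list" where
  "key_codes sb r a b c = (if sb b a = r then [sb c a] else [])"

fun all_key_codes :: "int \<Rightarrow> (int \<Rightarrow> int \<Rightarrow> int) \<Rightarrow> int \<Rightarrow> triple \<Rightarrow> int list" where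
  "all_key_codes n sb r (a, b, c) =
    (if a < n \<and> b < n \<and> c < n
     then key_codes sb r a b c @ key_codes sb r a c b @ key_codes sb r b a c @ key_codes sb r b c a @
       key_codes sb r c a b @ key_codes sb r c b a
     else [])"

definition scale_code :: "int \<Rightarrow> (int \<Rightarrow> int) \<Rightarrow> int \<Rightarrow> int" where
  "scale_code n sc p = (if p < n then sc p else p)"

fun scale_triple :: "int \<Rightarrow> (int \<Rightarrow> int) \<Rightarrow> triple \<Rightarrow> triple" where
  "scale_triple n sc (a, b, c) = (scale_code n sc a, scale_code n sc b, scale_code n sc c)"

fun iterates :: "nat \<Rightarrow> ('x \<Rightarrow> 'x) \<Rightarrow> 'x \<Rightarrow> 'x list" where
  "iterates 0 f x = []"
| "iterates (Suc k) f x = x # iterates k f (f x)"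

lemma set_iterates: "set (iterates m f x) = (\<lambda>i. (f ^^ i) x) ` {..<m}"
proof (induction m arbitrary: x)
  case (Suc m)
  have "{..<Suc m} = insert 0 (Suc ` {..<m})" by (auto simp: image_iff less_Suc_eq_0_disj)
  then show ?case
    using Suc[of "f x"] by (simp add: image_image funpow_swap1)
qed simp

lemma length_concat_iterates:
  assumes "\<And>xs. length (f xs) = length xs"
  shows "length (concat (iterates m f xs)) = m * length xs"
  using assms by (induction m arbitrary: xs) simp_all

text \<open>
  The class \<open>c0\<close> is invariant under multiplication by an element of order \<open>m\<close>; the other classes are
  the multiples of those in \<open>cs\<close>. It then suffices to check pairs and differences for representatives
  of the orbits.
\<close>

definition base_classes :: "int \<Rightarrow> (int \<Rightarrow> int) \<Rightarrow> nat \<Rightarrow> triple list \<Rightarrow> triple list list \<Rightarrow> triple list list" where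
  "base_classes n sc m c0 cs = c0 # concat (iterates m (map (map (scale_triple n sc))) cs)"

text \<open>
  The checks below are evaluated by rewriting. This takes quadratic time on long lists, hence the
  nested traversal, and it also rewrites below abstractions, hence the named predicates.
\<close>

definition gather :: "('x \<Rightarrow> 'y list) \<Rightarrow> 'x list list \<Rightarrow> 'y list" where
  "gather f xss = concat (map (\<lambda>xs. concat (map f xs)) xss)"

lemma gather_eq: "gather f xss = concat (map f (concat xss))"
  by (induction xss) (simp_all add: gather_def)

definition pairs_ok :: "int \<Rightarrow> triple list list \<Rightarrow> int \<Rightarrow> bool" where
  "pairs_ok n cl r \<longleftrightarrow> sort (gather (neighbours r) cl) = filter (\<lambda>p. p \<noteq> r) [0..n+1]"

text \<open>For an infinite point \<open>f\<close>: triples with \<open>f\<close> and two finite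
  points are classified up to translation by the difference of the latter, taken in both
  directions.\<close>

definition differences_ok :: "int \<Rightarrow> (int \<Rightarrow> int \<Rightarrow> int) \<Rightarrow> triple list list \<Rightarrow> int \<Rightarrow> bool" where
  "differences_ok n sb cl f \<longleftrightarrow> sort (gather (\<lambda>t. difference_codes n sb (neighbours f t)) cl) = [1..n-1]"

text \<open>For finite points: each triple {0, r, q} must be a translate of a block exactly once.
  The guard passes over 0 and the infinite points, which are not differences of distinct
  elements.\<close>

definition keys_ok :: "int \<Rightarrow> (int \<Rightarrow> int \<Rightarrow> int) \<Rightarrow> triple list list \<Rightarrow> int \<Rightarrow> bool" where
  "keys_ok n sb cl r \<longleftrightarrow>
    (if 0 < r \<and> r < n then sort (gather (all_key_codes n sb r) cl) = filter (\<lambda>p. p \<noteq> r) [1..n-1] else True)"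

definition rows_ok :: "int \<Rightarrow> (int \<Rightarrow> int \<Rightarrow> int) \<Rightarrow> int list \<Rightarrow> triple list list \<Rightarrow> bool" where
  "rows_ok n sb rs cl \<longleftrightarrow>
    list_all (pairs_ok n cl) rs \<and> list_all (differences_ok n sb cl) [n, n + 1] \<and> list_all (keys_ok n sb cl) rs"

text \<open>A fixed point must be listed once only, or the comparison of all orbits with
  \<open>[0..n+1]\<close> would fail for it when \<open>m > 1\<close>.\<close>

definition orbit_codes :: "int \<Rightarrow> (int \<Rightarrow> int) \<Rightarrow> nat \<Rightarrow> int \<Rightarrow> int list" where
  "orbit_codes n sc m r = (if scale_code n sc r = r then [r] else iterates m (scale_code n sc) r)"

text \<open>\<open>cs\<close> has to recur literally after \<open>m\<close> multiplications, while
  the blocks of \<open>c0\<close> are compared as sets, since multiplication may permute the points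
  inside a block.\<close>

definition base_classes_ok ::
  "int \<Rightarrow> (int \<Rightarrow> int \<Rightarrow> int) \<Rightarrow> (int \<Rightarrow> int) \<Rightarrow> nat \<Rightarrow> int list \<Rightarrow> triple list \<Rightarrow> triple list list \<Rightarrow> bool" where
  "base_classes_ok n sb sc m rs c0 cs \<longleftrightarrow> 0 < m \<and> list_all (\<lambda>r. 0 \<le> r \<and> r \<le> n + 1) rs \<and>
    ((map (map (scale_triple n sc))) ^^ m) cs = cs \<and>
    list_all (\<lambda>t. list_ex (\<lambda>t'. set (points t') = set (points (scale_triple n sc t))) c0) c0 \<and>
    sort (concat (map (orbit_codes n sc m) rs)) = [0..n+1] \<and>
    list_all (\<lambda>c. sort (concat (map points c)) = [0..n+1]) (base_classes n sc m c0 cs) \<and>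
    rows_ok n sb rs (base_classes n sc m c0 cs)"

text \<open>\<open>D_block\<close> is unchanged by e -> -e and \<open>Q_block_rotate\<close>
  identifies e with \<omega> e, so parameters are listed up to sign or up to powers of \<omega>.
  \<open>s\<close> and \<open>s'\<close> hold the parameters spent on the small classes.\<close>

definition orbit_class_ok ::
  "int \<Rightarrow> (int \<Rightarrow> int \<Rightarrow> int) \<Rightarrow> (int \<Rightarrow> int \<Rightarrow> int) \<Rightarrow> (int \<Rightarrow> int) \<Rightarrow> int list \<Rightarrow> int list \<Rightarrow>
    triple list \<Rightarrow> triple list \<Rightarrow> triple list \<Rightarrow> triple list \<Rightarrow> triple list \<Rightarrow> triple list \<Rightarrow> bool" where
  "orbit_class_ok n ad sb om s s' zs ds es ins qs rs \<longleftrightarrow>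
    list_all (in_range n [1, 2, 4]) (zs @ ds @ qs) \<and> list_all (in_range n [3, 5, 6]) (es @ rs) \<and>
    list_all (in_range n [1, 2, 3, 4, 5, 6]) ins \<and>
    list_ex (\<lambda>(e, x, h). x \<in> {1, 2, 4}) ins \<and> list_ex (\<lambda>(e, x, h). x \<in> {3, 5, 6}) ins \<and>
    map fst zs = [0..n-1] \<and>
    list_all (\<lambda>ds. sort (map fst ds @ map (\<lambda>d. sb 0 (fst d)) ds) = [1..n-1]) [ds, es] \<and>
    list_all (\<lambda>(s, qs). sort (s @ concat (map (\<lambda>(e, k, h). [e, om e, om (om e)]) qs)) = [0..n-1]) [(s, qs), (s', rs)] \<and>
    sort (concat (map points (map (Z_code n ad sb) zs @ map (D_code n ad sb) (ds @ es) @ map (I_code n) ins @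
      map (Q_code n ad om) (qs @ rs)))) = [0..7*n+1]"

section \<open>Decoding integers as points\<close>

locale coding =
  fixes n :: int and dec :: "int \<Rightarrow> 'a::{finite, comm_ring_1}" and ad sb :: "int \<Rightarrow> int \<Rightarrow> int"
    and om :: "int \<Rightarrow> int" and \<omega> :: 'a
  assumes n: "n = int CARD('a)" and dec_surj: "dec ` {0..<n} = UNIV" and dec_0: "dec 0 = 0"
    and dec_ad: "dec (ad i j) = dec i + dec j" and dec_sb: "dec (sb i j) = dec i - dec j"
    and dec_om: "dec (om i) = \<omega> * dec i"
    and ad_range: "ad i j \<in> {0..<n}" and sb_range: "sb i j \<in> {0..<n}" and om_range: "om i \<in> {0..<n}"
begin

lemma n_pos: "0 < n"
  by (simp add: n)

lemma obtain_dec: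
  obtains i where "0 \<le> i" "i < n" "x = dec i"
proof -
  have "x \<in> dec ` {0..<n}" using dec_surj by simp
  then show thesis using that by auto
qed

definition pdec :: "int \<Rightarrow> 'a point" where
  "pdec p = (if p = 7 * n then Infty True else if p = 7 * n + 1 then Infty False
    else Pt (of_int (p div n)) (dec (p mod n)))"

lemma pdec_Pt:
  assumes "0 \<le> x" "x < 7" "0 \<le> h" "h < n"
  shows "pdec (x * n + h) = Pt (of_int x) (dec h)"
proof -
  have "x * n \<le> 6 * n" using assms n_pos by (intro mult_right_mono) auto
  then have "x * n + h < 7 * n" using assms by linarith
  moreover have "(x * n + h) div n = x" "(x * n + h) mod n = h"
    using assms by simp_all
  ultimately show ?thesis by (simp add: pdec_def)
qed

lemma pdec_Infty: "pdec (7 * n) = Infty True" "pdec (7 * n + 1) = Infty False"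
  by (simp_all add: pdec_def)

lemma pdec_surj: "pdec ` {0..7 * n + 1} = UNIV"
proof -
  have "p \<in> pdec ` {0..7 * n + 1}" for p
  proof (cases p)
    case (Inl a)
    obtain x h where p: "p = Pt x h" using Inl by (cases a) auto
    obtain z where z: "x = of_int z" "0 \<le> z" "z < 7"
      by (cases x) auto
    obtain i where i: "0 \<le> i" "i < n" "h = dec i" by (rule obtain_dec)
    have "z * n \<le> 6 * n" "0 \<le> z * n"
      using z n_pos by (auto intro: mult_right_mono)
    then have "z * n + i \<in> {0..7 * n + 1}"
      using i n_pos unfolding atLeastAtMost_iff by linarith
    moreover have "p = pdec (z * n + i)" using p z i by (simp add: pdec_Pt)
    ultimately show ?thesis by blast
  next
    case (Inr b)
    then have "p = pdec (if b then 7 * n else 7 * n + 1)" by (simp add: pdec_Infty)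
    then show ?thesis using n_pos by (intro image_eqI) auto
  qed
  then show ?thesis by blast
qed

definition adec :: "int \<Rightarrow> 'a + bool" where
  "adec p = (if p = n then Inr True else if p = n + 1 then Inr False else Inl (dec p))"

lemma adec_simps: "p < n \<Longrightarrow> adec p = Inl (dec p)" "adec n = Inr True" "adec (n + 1) = Inr False"
  by (auto simp: adec_def)

lemma adec_surj: "adec ` {0..n+1} = UNIV"
proof -
  have "p \<in> adec ` {0..n+1}" for p
  proof (cases p)
    case (Inl h)
    obtain i where "0 \<le> i" "i < n" "h = dec i" by (rule obtain_dec)
    then have "p = adec i" "i \<in> {0..n+1}" using Inl by (auto simp: adec_def)
    then show ?thesis by blast
  next
    case (Inr b)
    then have "p = adec (if b then n else n + 1)" by (simp add: adec_def)
    then show ?thesis using n_pos by (intro image_eqI) auto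
  qed
  then show ?thesis by blast
qed

definition tri :: "(int \<Rightarrow> 'p) \<Rightarrow> triple \<Rightarrow> 'p set" where
  "tri f t = f ` set (points t)"

lemma tri_simp: "tri f (a, b, c) = {f a, f b, f c}"
  by (simp add: tri_def)

lemma partition_tri:
  fixes f :: "int \<Rightarrow> 'p::finite"
  assumes s: "sort (concat (map points ts)) = [0..m]" and surj: "f ` {0..m} = UNIV" and m: "m + 1 = int CARD('p)"
  shows "partition_on UNIV (set (map (tri f) ts))" "\<And>b. b \<in> set (map (tri f) ts) \<Longrightarrow> card b = 3"
proof -
  have lp: "length (points t) = 3" for t
    by (cases t) auto
  have "length (concat (map points ts)) = 3 * length ts"
    by (induction ts) (simp_all add: lp)
  moreover have "length (concat (map points ts)) = nat (m + 1)"
    using arg_cong[OF s, of length] by simp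
  ultimately have len: "3 * length (map (tri f) ts) = CARD('p)"
    using m by simp
  have card: "card b \<le> 3" if "b \<in> set (map (tri f) ts)" for b
  proof -
    obtain t where "b = f ` set (points t)" using \<open>b \<in> _\<close> by (auto simp: tri_def)
    then show ?thesis
      using card_image_le[of "set (points t)" f] card_length[of "points t"] lp[of t] by simp
  qed
  have "set (concat (map points ts)) = {0..m}"
    using set_if_sort_eq[OF s] by simp
  then have "f ` set (concat (map points ts)) = UNIV"
    using surj by simp
  then have cover: "\<Union>(set (map (tri f) ts)) = UNIV"
    by (simp add: tri_def image_UN)
  show "partition_on UNIV (set (map (tri f) ts))" "\<And>b. b \<in> set (map (tri f) ts) \<Longrightarrow> card b = 3"
    using partition_on_if_covering[OF len card cover] by blast+
qed

end

section \<open>From checks on orbit representatives to all pairs and triples of the small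
  system\<close>

definition translate :: "'a::comm_ring_1 \<Rightarrow> 'a + bool \<Rightarrow> 'a + bool" where
  "translate t = map_sum (\<lambda>h. h + t) id"

definition scale :: "'a::comm_ring_1 \<Rightarrow> 'a + bool \<Rightarrow> 'a + bool" where
  "scale s = map_sum ((*) s) id"

lemma translate_simps [simp]: "translate t (Inl h) = Inl (h + t)" "translate t (Inr b) = Inr b"
  by (simp_all add: translate_def)

lemma scale_simps [simp]: "scale s (Inl h) = Inl (s * h)" "scale s (Inr b) = Inr b"
  by (simp_all add: scale_def)

lemma scale_translate: "scale s (translate h x) = translate (s * h) (scale s x)"
  by (cases x) (simp_all add: distrib_left)

lemma scale_power_Inl: "(scale s ^^ i) (Inl h) = Inl (s ^ i * h)"
  by (induction i) (simp_all add: mult.assoc)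

locale multiplied_coding = coding n dec ad sb om \<omega>
  for n and dec :: "int \<Rightarrow> 'a::{finite, comm_ring_1}" and ad sb om \<omega> +
  fixes sc :: "int \<Rightarrow> int" and s s' :: 'a and m :: nat and reps :: "int list"
    and c0 :: "triple list" and cs :: "triple list list"
  assumes dec_sc: "dec (sc i) = s * dec i" and sc_range: "sc i \<in> {0..<n}" and s_unit: "s * s' = 1"
    and ok: "base_classes_ok n sb sc m reps c0 cs"
begin

abbreviation cl :: "triple list list" where "cl \<equiv> base_classes n sc m c0 cs"

lemma class_sorted: "c \<in> set cl \<Longrightarrow> sort (concat (map points c)) = [0..n+1]"
  using ok by (simp add: base_classes_ok_def list_all_iff)

lemma base_partition:
  assumes "c \<in> set cl"
  shows "partition_on UNIV (set (map (tri adec) c))" "\<And>b. b \<in> set (map (tri adec) c) \<Longrightarrow> card b = 3"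
  using partition_tri[OF class_sorted[OF assms], of adec] adec_surj by (simp_all add: n card_UNIV_sum)

lemma base_range:
  assumes "t \<in> set (concat cl)" "p \<in> set (points t)"
  shows "0 \<le> p" "p \<le> n + 1"
proof -
  obtain c where c: "c \<in> set cl" "t \<in> set c" using assms(1) by auto
  have "p \<in> set (concat (map points c))" using c(2) assms(2) by auto
  then have "p \<in> set [0..n+1]"
    unfolding set_if_sort_eq[OF class_sorted[OF c(1)]] .
  then show "0 \<le> p" "p \<le> n + 1" by auto
qed

lemma adec_scale_code:
  assumes "p \<le> n + 1"
  shows "adec (scale_code n sc p) = scale s (adec p)"
proof -
  consider "p < n" | "p = n" | "p = n + 1" using assms by linarith
  then show ?thesis
    by cases (use sc_range[of p] in \<open>simp_all add: scale_code_def adec_def dec_sc\<close>)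
qed

lemma scale_code_range:
  assumes "p \<le> n + 1"
  shows "scale_code n sc p \<le> n + 1"
  using assms sc_range[of p] by (simp add: scale_code_def)

lemma adec_scale_power:
  assumes "p \<le> n + 1"
  shows "adec ((scale_code n sc ^^ i) p) = (scale s ^^ i) (adec p) \<and> (scale_code n sc ^^ i) p \<le> n + 1"
  by (induction i) (use assms in \<open>simp_all add: adec_scale_code scale_code_range\<close>)

lemma tri_scale:
  assumes "t \<in> set (concat cl)"
  shows "tri adec (scale_triple n sc t) = scale s ` tri adec t"
proof -
  obtain a b c where "t = (a, b, c)" by (cases t)
  then show ?thesis
    using base_range(2)[OF assms] by (simp add: tri_simp adec_scale_code)
qed

text \<open>This invariance under the multiplier justifies checking only representatives of its
  orbits.\<close>

lemma blocks_closed: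
  assumes t: "t \<in> set (concat cl)"
  shows "\<exists>t'\<in>set (concat cl). tri adec t' = scale s ` tri adec t"
proof -
  let ?F = "map (map (scale_triple n sc))"
  have m: "0 < m" and per: "(?F ^^ m) cs = cs"
    and c0: "list_all (\<lambda>t. list_ex (\<lambda>t'. set (points t') = set (points (scale_triple n sc t))) c0) c0"
    using ok unfolding base_classes_ok_def by blast+
  have set_cl: "set cl = insert c0 (\<Union>i<m. set ((?F ^^ i) cs))"
    by (simp add: base_classes_def set_iterates)
  obtain c where c: "c \<in> set cl" "t \<in> set c" using t by auto
  then consider "c = c0" | i where "i < m" "c \<in> set ((?F ^^ i) cs)"
    unfolding set_cl by blast
  then show ?thesis
  proof cases
    case 1
    then obtain t' where t': "t' \<in> set c0" "set (points t') = set (points (scale_triple n sc t))"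
      using c0 c(2) by (auto simp: list_all_iff list_ex_iff)
    then have "t' \<in> set (concat cl)" "tri adec t' = tri adec (scale_triple n sc t)"
      by (simp_all add: base_classes_def tri_def)
    then show ?thesis using tri_scale[OF t] by blast
  next
    case 2
    \<comment> \<open>The m-th multiple of \<open>cs\<close> is \<open>cs\<close> again, so the
      successor of the last index is 0.\<close>
    define j where "j = (if Suc i < m then Suc i else 0)"
    have "(?F ^^ j) cs = ?F ((?F ^^ i) cs)"
    proof (cases "Suc i < m")
      case False
      then have "m = Suc i" using 2(1) by simp
      then have "?F ((?F ^^ i) cs) = cs" using per by simp
      then show ?thesis using False by (simp add: j_def)
    qed (simp add: j_def)
    then have "map (scale_triple n sc) c \<in> set ((?F ^^ j) cs)"
      using 2(2) by simp
    moreover have "j < m" using m by (simp add: j_def)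
    ultimately have "map (scale_triple n sc) c \<in> set cl"
      unfolding set_cl by blast
    moreover have "scale_triple n sc t \<in> set (map (scale_triple n sc) c)"
      using c(2) by simp
    ultimately have "scale_triple n sc t \<in> set (concat cl)"
      unfolding set_concat by blast
    then show ?thesis using tri_scale[OF t] by blast
  qed
qed

lemma scale_inverse: "scale s (scale s' x) = x"
  using s_unit by (cases x) (simp_all add: mult.assoc[symmetric])

lemma scale_power_surj: "\<exists>y. (scale s ^^ i) y = x"
proof (induction i arbitrary: x)
  case (Suc i)
  obtain y where "(scale s ^^ i) y = scale s' x" using Suc by blast
  then have "(scale s ^^ Suc i) y = x" by (simp add: scale_inverse)
  then show ?case by blast
qed simp

lemma representative:
  obtains r i where "r \<in> set reps" "0 \<le> r" "r \<le> n + 1" "x = (scale s ^^ i) (adec r)"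
proof -
  have reps: "list_all (\<lambda>r. 0 \<le> r \<and> r \<le> n + 1) reps"
    and rep: "sort (concat (map (orbit_codes n sc m) reps)) = [0..n+1]"
    using ok unfolding base_classes_ok_def by blast+
  have "x \<in> adec ` {0..n+1}"
    by (simp only: adec_surj UNIV_I)
  then obtain p where p: "x = adec p" "p \<in> set [0..n+1]" by auto
  then have "p \<in> set (concat (map (orbit_codes n sc m) reps))"
    unfolding set_if_sort_eq[OF rep] by blast
  then obtain q where q: "q \<in> set reps" "p \<in> set (orbit_codes n sc m q)" by auto
  have "\<exists>i. (scale_code n sc ^^ i) q = p"
  proof (cases "scale_code n sc q = q")
    case True
    then have "(scale_code n sc ^^ 0) q = p"
      using q(2) by (simp add: orbit_codes_def)
    then show ?thesis by blast
  next
    case False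
    then show ?thesis
      using q(2) by (auto simp: orbit_codes_def set_iterates)
  qed
  then obtain r i where ri: "r \<in> set reps" "(scale_code n sc ^^ i) r = p"
    using q(1) by blast
  have r: "0 \<le> r" "r \<le> n + 1"
    using reps ri(1) by (auto simp: list_all_iff)
  have "x = (scale s ^^ i) (adec r)"
    using adec_scale_power[OF r(2), of i] ri(2) p(1) by simp
  then show thesis using that ri(1) r by blast
qed

definition paired :: "'a + bool \<Rightarrow> 'a + bool \<Rightarrow> bool" where
  "paired x y \<longleftrightarrow> (\<exists>t\<in>set (concat cl). {x, y} \<subseteq> tri adec t)"

lemma rows: "rows_ok n sb reps cl"
  using ok unfolding base_classes_ok_def by blast

lemma neighbours_points: "q \<in> set (neighbours r t) \<Longrightarrow> q \<in> set (points t) \<and> r \<in> set (points t)"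
  by (cases t) (auto split: if_splits)

lemma neighbours_eq: "neighbours r t = [x, y] \<Longrightarrow> set (points t) = {r, x, y}"
  by (cases t) (auto split: if_splits)

lemma paired_row:
  assumes r: "r \<in> set reps" and q: "0 \<le> q" "q \<le> n + 1" "q \<noteq> r"
  shows "paired (adec r) (adec q)"
proof -
  have "sort (concat (map (neighbours r) (concat cl))) = filter (\<lambda>p. p \<noteq> r) [0..n+1]"
    using rows r unfolding rows_ok_def list_all_iff pairs_ok_def gather_eq by blast
  from set_if_sort_eq[OF this]
  have "q \<in> set (concat (map (neighbours r) (concat cl)))"
    using q by simp
  then obtain t where t: "t \<in> set (concat cl)" "q \<in> set (neighbours r t)" by auto
  then have "{adec r, adec q} \<subseteq> tri adec t"
    using neighbours_points[OF t(2)] by (simp add: tri_def)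
  then show ?thesis using t(1) unfolding paired_def by blast
qed

lemma paired_scale:
  assumes "paired x y"
  shows "paired ((scale s ^^ i) x) ((scale s ^^ i) y)"
proof (induction i)
  case (Suc i)
  then obtain t where t: "t \<in> set (concat cl)" "{(scale s ^^ i) x, (scale s ^^ i) y} \<subseteq> tri adec t"
    unfolding paired_def by blast
  obtain t' where "t' \<in> set (concat cl)" "tri adec t' = scale s ` tri adec t"
    using blocks_closed[OF t(1)] by blast
  moreover have "{(scale s ^^ Suc i) x, (scale s ^^ Suc i) y} \<subseteq> scale s ` tri adec t"
    using t(2) by auto
  ultimately show ?case
    unfolding paired_def by metis
qed (simp add: assms)

text \<open>\<open>paired\<close> is preserved by scaling and scaling is surjective, so
  \<open>x\<close> may be taken to be a representative.\<close>

lemma base_pairs: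
  assumes "x \<noteq> y"
  shows "paired x y"
proof -
  obtain r i where r: "r \<in> set reps" "0 \<le> r" "r \<le> n + 1" "x = (scale s ^^ i) (adec r)"
    by (rule representative)
  obtain z where z: "(scale s ^^ i) z = y" using scale_power_surj by blast
  have "z \<in> adec ` {0..n+1}"
    by (simp only: adec_surj UNIV_I)
  then obtain q where q: "z = adec q" "0 \<le> q" "q \<le> n + 1" by auto
  have "q \<noteq> r" using assms r(4) z q(1) by auto
  then have "paired (adec r) z"
    unfolding q(1) using paired_row r(1) q(2,3) by blast
  then show ?thesis
    using paired_scale[of "adec r" z i] z r(4) by simp
qed

definition developed :: "('a + bool) set \<Rightarrow> bool" where
  "developed T \<longleftrightarrow> (\<exists>t\<in>set (concat cl). \<exists>h. T = translate h ` tri adec t)"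

lemma developed_translate:
  assumes "developed T"
  shows "developed (translate h ` T)"
proof -
  obtain t g where t: "t \<in> set (concat cl)" "T = translate g ` tri adec t"
    using assms unfolding developed_def by blast
  have "translate h (translate g x) = translate (g + h) x" for x :: "'a + bool"
    by (cases x) (simp_all add: add.assoc)
  then have "translate h ` T = translate (g + h) ` tri adec t"
    unfolding t(2) by (simp add: image_image)
  then show ?thesis using t(1) unfolding developed_def by blast
qed

lemma developed_scale:
  assumes "developed T"
  shows "developed ((scale s ^^ i) ` T)"
proof (induction i)
  case (Suc i)
  then obtain t h where t: "t \<in> set (concat cl)" "(scale s ^^ i) ` T = translate h ` tri adec t"
    unfolding developed_def by blast
  obtain t' where t': "t' \<in> set (concat cl)" "tri adec t' = scale s ` tri adec t"
    using blocks_closed[OF t(1)] by blast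
  have "(scale s ^^ Suc i) ` T = scale s ` (scale s ^^ i) ` T"
    by (simp add: image_comp)
  also have "\<dots> = translate (s * h) ` tri adec t'"
    unfolding t(2) t'(2) by (simp add: image_image scale_translate)
  finally show ?case using t'(1) unfolding developed_def by blast
qed (simp add: assms)

text \<open>The block through both infinite points has one finite point, and translation moves that
  point anywhere.\<close>

lemma developed_Infty_Infty:
  assumes "b \<noteq> c"
  shows "developed {Inr b, Inr c, Inl u}"
proof -
  obtain t where t: "t \<in> set (concat cl)" "{Inr b, Inr c} \<subseteq> tri adec t"
    using base_pairs[of "Inr b" "Inr c"] assms by (auto simp: paired_def)
  obtain c' where c': "c' \<in> set cl" "t \<in> set c'"
    using t(1) by auto
  have "card (tri adec t) = 3"
    using base_partition(2)[OF c'(1)] c'(2) by simp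
  then have "card (tri adec t - {Inr b, Inr c}) = 1"
    using t(2) assms by (simp add: card_Diff_subset)
  then obtain z where z: "tri adec t - {Inr b, Inr c} = {z}"
    by (rule card_1_singletonE)
  then have eq: "tri adec t = {Inr b, Inr c, z}" and "z \<noteq> Inr b" "z \<noteq> Inr c"
    using t(2) by blast+
  then obtain v where "z = Inl v"
    using assms by (cases z) auto
  then have "{Inr b, Inr c, Inl u} = translate (u - v) ` tri adec t"
    unfolding eq by simp
  then show ?thesis
    using t(1) unfolding developed_def by blast
qed

lemma developed_Infty:
  assumes "u \<noteq> v"
  shows "developed {Inr i, Inl u, Inl v}"
proof -
  define f where "f = (if i then n else n + 1)"
  have f: "adec f = Inr i" "f \<in> set [n, n + 1]"
    by (simp_all add: f_def adec_simps)
  have "sort (concat (map (\<lambda>t. difference_codes n sb (neighbours f t)) (concat cl))) = [1..n-1]"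
    using rows f(2) unfolding rows_ok_def list_all_iff differences_ok_def gather_eq by blast
  from set_if_sort_eq[OF this]
  have eq: "(\<Union>t\<in>set (concat cl). set (difference_codes n sb (neighbours f t))) = {1..n-1}"
    by simp
  obtain d where d: "0 \<le> d" "d < n" "u - v = dec d" by (rule obtain_dec)
  then have "d \<noteq> 0" using dec_0 assms by auto
  then have "d \<in> (\<Union>t\<in>set (concat cl). set (difference_codes n sb (neighbours f t)))"
    unfolding eq using d by simp
  then obtain t where t: "t \<in> set (concat cl)" "d \<in> set (difference_codes n sb (neighbours f t))" by blast
  obtain a b where ab: "neighbours f t = [a, b]" "a < n" "b < n" "d = sb a b \<or> d = sb b a"
    using t(2) by (cases "(n, sb, neighbours f t)" rule: difference_codes.cases) (auto split: if_splits)
  have "u - v = dec b - dec a \<or> u - v = dec a - dec b"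
    using d(3) ab(4) by (auto simp: dec_sb)
  moreover have tri: "tri adec t = {Inr i, Inl (dec a), Inl (dec b)}"
    unfolding tri_def neighbours_eq[OF ab(1)] using ab(2,3) f(1) by (simp add: adec_simps)
  ultimately show ?thesis
  proof (elim disjE)
    assume "u - v = dec b - dec a"
    then have "dec a + (u - dec b) = v" by (simp add: algebra_simps)
    then have "{Inr i, Inl u, Inl v} = translate (u - dec b) ` tri adec t"
      unfolding tri by auto
    then show ?thesis using t(1) unfolding developed_def by blast
  next
    assume "u - v = dec a - dec b"
    then have "dec b + (u - dec a) = v" by (simp add: algebra_simps)
    then have "{Inr i, Inl u, Inl v} = translate (u - dec a) ` tri adec t"
      unfolding tri by auto
    then show ?thesis using t(1) unfolding developed_def by blast
  qed
qed

lemma developed_representative: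
  assumes r: "r \<in> set reps" "0 < r" "r < n" and q: "0 < q" "q < n" "q \<noteq> r"
  shows "developed {Inl 0, Inl (dec r), Inl (dec q)}"
proof -
  have "keys_ok n sb cl r"
    using rows r(1) unfolding rows_ok_def list_all_iff by blast
  then have "sort (concat (map (all_key_codes n sb r) (concat cl))) = filter (\<lambda>p. p \<noteq> r) [1..n-1]"
    using r(2,3) unfolding keys_ok_def gather_eq by simp
  from set_if_sort_eq[OF this]
  have "q \<in> set (concat (map (all_key_codes n sb r) (concat cl)))"
    using q by simp
  then obtain t where t: "t \<in> set (concat cl)" "q \<in> set (all_key_codes n sb r t)" by auto
  obtain a b c where abc: "t = (a, b, c)" by (cases t)
  have lt: "a < n" "b < n" "c < n"
    using t(2) unfolding abc by (auto split: if_splits)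
  have tri: "tri adec t = {Inl (dec a), Inl (dec b), Inl (dec c)}"
    unfolding abc tri_simp using lt by (simp add: adec_simps)
  have key: "developed {Inl 0, Inl (dec r), Inl (dec q)}"
    if "q \<in> set (key_codes sb r x y z)" "tri adec t = {Inl (dec x), Inl (dec y), Inl (dec z)}" for x y z
  proof -
    have "r = sb y x" "q = sb z x"
      using that(1) by (auto simp: key_codes_def split: if_splits)
    then have "{Inl 0, Inl (dec r), Inl (dec q)} = translate (- dec x) ` tri adec t"
      unfolding that(2) by (simp add: dec_sb)
    then show ?thesis using t(1) unfolding developed_def by blast
  qed
  have "q \<in> set (key_codes sb r a b c) \<union> set (key_codes sb r a c b) \<union> set (key_codes sb r b a c) \<union>
      set (key_codes sb r b c a) \<union> set (key_codes sb r c a b) \<union> set (key_codes sb r c b a)"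
    using t(2) lt unfolding abc by auto
  then show ?thesis
    using key[of a b c] key[of a c b] key[of b a c] key[of b c a] key[of c a b] key[of c b a] unfolding tri
    by (auto simp: insert_commute)
qed

text \<open>Translating \<open>u\<close> to 0 and scaling v - u back to a representative reduces the
  triple to one covered by \<open>keys_ok\<close>.\<close>

lemma developed_finite:
  assumes "u \<noteq> v" "u \<noteq> w" "v \<noteq> w"
  shows "developed {Inl u, Inl v, Inl w}"
proof -
  obtain r i where r: "r \<in> set reps" "0 \<le> r" "r \<le> n + 1" "Inl (v - u) = (scale s ^^ i) (adec r)"
    by (rule representative)
  have inr: "(scale s ^^ i) (Inr b) = Inr b" for b i
    by (induction i) simp_all
  have "r < n"
  proof (rule ccontr)
    assume "\<not> r < n"
    then have "r = n \<or> r = n + 1" using r(3) by linarith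
    then show False using r(4) by (auto simp: adec_simps inr)
  qed
  then have vu: "v - u = s ^ i * dec r"
    using r(4) by (simp add: adec_simps scale_power_Inl)
  have "r \<noteq> 0" using vu assms(1) dec_0 by auto
  then have "0 < r" using r(2) by simp
  obtain y where y: "(scale s ^^ i) y = Inl (w - u)" using scale_power_surj by blast
  then obtain z where z: "y = Inl z"
    by (cases y) (auto simp: inr)
  then have wu: "w - u = s ^ i * z"
    using y by (simp add: scale_power_Inl)
  obtain q where q: "0 \<le> q" "q < n" "z = dec q" by (rule obtain_dec)
  have "q \<noteq> 0" using wu assms(2) dec_0 q(3) by auto
  moreover have "q \<noteq> r"
  proof
    assume "q = r"
    then have "v - u = w - u" using vu wu q(3) by simp
    then show False using assms(3) by simp
  qed
  ultimately have "developed {Inl 0, Inl (dec r), Inl (dec q)}"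
    using developed_representative r(1) \<open>0 < r\<close> \<open>r < n\<close> q(1,2) by simp
  from developed_scale[OF this, of i]
  have "developed {Inl 0, Inl (v - u), Inl (w - u)}"
    by (simp add: scale_power_Inl vu wu q(3))
  from developed_translate[OF this, of u] show ?thesis by simp
qed

lemma base_triples:
  assumes "card T = 3"
  shows "developed T"
  using assms developed_finite developed_Infty developed_Infty_Infty
  by (rule sum_bool_triple_cases)

end

section \<open>Decoding the parameter lists as blocks\<close>

context coding
begin

lemma seven_eq: "(7::7) = 0"
  by simp

lemma tri_Z_code:
  assumes "in_range n [1, 2, 4] (e, d, h)"
  shows "tri pdec (Z_code n ad sb (e, d, h)) = Z_block (of_int d) (dec e) (dec h)"
proof -
  have d: "0 \<le> d" "d < 7" "0 \<le> 7 - d" "7 - d < 7" and h: "0 \<le> h" "h < n"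
    using assms by (auto simp: in_range_def)
  show ?thesis
    using pdec_Pt[of 0 h] pdec_Pt[OF d(1,2), of "ad h e"] pdec_Pt[OF d(3,4), of "sb h e"] h
      ad_range[of h e] sb_range[of h e]
    by (simp add: tri_simp Z_block_def dec_ad dec_sb seven_eq)
qed

lemma of_int_mod_7: "(of_int (z mod 7) :: 7) = of_int z"
proof -
  have "(of_int z :: 7) = of_int (7 * (z div 7) + z mod 7)" by simp
  also have "\<dots> = 7 * of_int (z div 7) + of_int (z mod 7)" by (simp only: of_int_add of_int_mult of_int_numeral)
  finally show ?thesis by (simp only: seven_eq mult_zero_left add_0_left)
qed

lemma mod_7_bounds: "0 \<le> z mod 7" "z mod 7 < (7 :: int)"
  by simp_all

lemma five_eq: "(5::7) = - 2"
  by simp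

lemma tri_D_code:
  assumes "in_range n ks (e, x, h)" "set ks \<subseteq> {1..6}"
  shows "tri pdec (D_code n ad sb (e, x, h)) = D_block (of_int x) (dec e) (dec h)"
proof -
  have x: "0 \<le> x" "x < 7" and h: "0 \<le> h" "h < n"
    using assms by (auto simp: in_range_def)
  have "(of_int (5 * x mod 7) :: 7) = - 2 * of_int x"
    unfolding of_int_mod_7 by (simp only: of_int_mult of_int_numeral five_eq)
  then show ?thesis
    using pdec_Pt[OF mod_7_bounds, of h "5 * x"] pdec_Pt[OF x, of "ad h e"] pdec_Pt[OF x, of "sb h e"] h
      ad_range[of h e] sb_range[of h e]
    by (simp add: tri_simp D_block_def dec_ad dec_sb)
qed

lemma of_int_QR:
  assumes "x \<in> {1..6}"
  shows "(of_int x :: 7) \<in> QR \<longleftrightarrow> x \<in> {1, 2, 4}" "(of_int x :: 7) \<in> NR \<longleftrightarrow> x \<in> {3, 5, 6}"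
proof -
  have "x \<in> {1, 2, 3, 4, 5, 6}" using assms by auto
  then show "(of_int x :: 7) \<in> QR \<longleftrightarrow> x \<in> {1, 2, 4}" "(of_int x :: 7) \<in> NR \<longleftrightarrow> x \<in> {3, 5, 6}"
    by (auto simp: QR_def NR_def)
qed

lemma tri_I_code:
  assumes "in_range n ks (e, x, h)" "set ks \<subseteq> {1..6}"
  shows "tri pdec (I_code n (e, x, h)) = I_block (of_int x) (dec h)"
proof -
  have x: "0 \<le> x" "x < 7" "x \<in> {1..6}" and h: "0 \<le> h" "h < n"
    using assms by (auto simp: in_range_def)
  have "(of_int (5 * x mod 7) :: 7) = - 2 * of_int x"
    unfolding of_int_mod_7 by (simp only: of_int_mult of_int_numeral five_eq)
  then show ?thesis
    using pdec_Pt[OF mod_7_bounds h, of "5 * x"] pdec_Pt[OF x(1,2) h] of_int_QR(1)[OF x(3)]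
    by (auto simp: tri_simp I_block_def pdec_Infty)
qed

lemma tri_Q_code:
  assumes "in_range n ks (e, k, h)" "set ks \<subseteq> {1..6}"
  shows "tri pdec (Q_code n ad om (e, k, h)) = Q_block \<omega> (of_int k) (dec e) (dec h)"
proof -
  have k: "0 \<le> k" "k < 7" and h: "0 \<le> h" "h < n"
    using assms by (auto simp: in_range_def)
  have "(of_int (2 * k mod 7) :: 7) = 2 * of_int k" "(of_int (4 * k mod 7) :: 7) = 4 * of_int k"
    unfolding of_int_mod_7 by simp_all
  then show ?thesis
    using pdec_Pt[OF k h] pdec_Pt[OF mod_7_bounds, of "ad h e" "2 * k"]
      pdec_Pt[OF mod_7_bounds, of "ad (ad h e) (om e)" "4 * k"] ad_range[of h e] ad_range[of "ad h e" "om e"]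
    by (simp add: tri_simp Q_block_def dec_ad dec_om)
qed

end

context multiplied_coding
begin

text \<open>The i-th entries of \<open>sl\<close> and \<open>sl'\<close> become \<alpha> and \<beta>
  of the i-th class. The conditions on \<open>P0\<close> involve only the sets of these values, so
  pairing by position is harmless.\<close>

theorem large_set_from_codes:
  fixes half third :: 'a
  assumes omega: "1 + \<omega> + \<omega> * \<omega> = 0" and half: "2 * half = 1" and third: "3 * third = 1"
    and P: "orbit_class_ok n ad sb om sl sl' zs ds es ins qs rs"
    and len: "2 * length cl = CARD('a) + 1" "length sl = length cl" "length sl' = length cl"
  shows "\<exists>(X :: nat set) \<L>. large_set_KTS (7 * CARD('a) + 2) X \<L>"
proof -
  define bs where "bs = map (Z_code n ad sb) zs @ map (D_code n ad sb) (ds @ es) @ map (I_code n) ins @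
      map (Q_code n ad om) (qs @ rs)"
  define P0 where "P0 = set (map (tri pdec) bs)"
  have ranges: "list_all (in_range n [1, 2, 4]) (zs @ ds @ qs)" "list_all (in_range n [3, 5, 6]) (es @ rs)"
      "list_all (in_range n [1, 2, 3, 4, 5, 6]) ins"
    and ins: "list_ex (\<lambda>(e, x, h). x \<in> {1, 2, 4}) ins" "list_ex (\<lambda>(e, x, h). x \<in> {3, 5, 6}) ins"
    and zs: "map fst zs = [0..n-1]"
    and dses: "list_all (\<lambda>ds. sort (map fst ds @ map (\<lambda>d. sb 0 (fst d)) ds) = [1..n-1]) [ds, es]"
    and sqs: "list_all (\<lambda>(sl, qs). sort (sl @ concat (map (\<lambda>(e, k, h). [e, om e, om (om e)]) qs)) = [0..n-1])
      [(sl, qs), (sl', rs)]"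
    and sort_bs: "sort (concat (map points bs)) = [0..7*n+1]"
    using P unfolding orbit_class_ok_def bs_def by blast+
  have QR: "(of_int k :: 7) \<in> QR" if "in_range n [1, 2, 4] (e, k, h)" for e k h
    using that of_int_QR(1)[of k] by (auto simp: in_range_def)
  have NR: "(of_int k :: 7) \<in> NR" if "in_range n [3, 5, 6] (e, k, h)" for e k h
    using that of_int_QR(2)[of k] by (auto simp: in_range_def)
  have sub: "set [1, 2, 4 :: int] \<subseteq> {1..6}" "set [3, 5, 6 :: int] \<subseteq> {1..6}" "set [1, 2, 3, 4, 5, 6 :: int] \<subseteq> {1..6}"
    by auto
  have in_P0: "tri pdec t \<in> P0" if "t \<in> set bs" for t
    using that by (simp add: P0_def)
  have D: "\<exists>x\<in>R. \<exists>h. D_block x e h \<in> P0"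
    if e: "e \<noteq> 0" and l: "l = ds \<and> ks = [1, 2, 4] \<and> R = QR \<or> l = es \<and> ks = [3, 5, 6] \<and> R = NR"
    for e R l and ks :: "int list"
  proof -
    have "sort (map fst l @ map (\<lambda>d. sb 0 (fst d)) l) = [1..n-1]" and lr: "list_all (in_range n ks) l"
      and lb: "D_code n ad sb ` set l \<subseteq> set bs"
      using l dses ranges by (auto simp: bs_def)
    from set_if_sort_eq[OF this(1)]
    have eq: "fst ` set l \<union> (\<lambda>d. sb 0 (fst d)) ` set l = {1..n-1}"
      by simp
    obtain i where i: "0 \<le> i" "i < n" "e = dec i" by (rule obtain_dec)
    then have "i \<noteq> 0" using e dec_0 by auto
    then have "i \<in> fst ` set l \<union> (\<lambda>d. sb 0 (fst d)) ` set l"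
      unfolding eq using i by simp
    then obtain t where t: "t \<in> set l" "i = fst t \<or> i = sb 0 (fst t)" by blast
    obtain e' x h where exh: "t = (e', x, h)" by (cases t)
    have r: "in_range n ks (e', x, h)" using lr t(1) exh by (auto simp: list_all_iff)
    have ks: "set ks \<subseteq> {1..6}" using l by auto
    have "D_block (of_int x) (dec e') (dec h) \<in> P0"
      using in_P0[of "D_code n ad sb t"] lb t(1) unfolding exh tri_D_code[OF r ks] by blast
    \<comment> \<open>Only one of e and -e is listed; changing the sign just exchanges two points of
      the block.\<close>
    moreover have "D_block y (- d) g = D_block y d g" for y :: 7 and d g :: 'a
      by (auto simp: D_block_def)
    ultimately have "D_block (of_int x) e (dec h) \<in> P0"
      using t(2) i(3) by (auto simp: exh dec_sb dec_0)
    moreover have "of_int x \<in> R" using l QR NR r by blast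
    ultimately show ?thesis by blast
  qed
  have Q: "e \<in> (\<lambda>i. dec (s0 ! i)) ` {..<length cl} \<or> (\<exists>k\<in>R. \<exists>h. Q_block \<omega> k e h \<in> P0)"
    if l: "l = qs \<and> ks = [1, 2, 4] \<and> R = QR \<and> s0 = sl \<or> l = rs \<and> ks = [3, 5, 6] \<and> R = NR \<and> s0 = sl'"
    for e R l s0 and ks :: "int list"
  proof -
    have srt: "sort (s0 @ concat (map (\<lambda>(e, k, h). [e, om e, om (om e)]) l)) = [0..n-1]"
      and lr: "list_all (in_range n ks) l" and lb: "Q_code n ad om ` set l \<subseteq> set bs" and ls: "length s0 = length cl"
      using l sqs ranges len by (auto simp: bs_def)
    from set_if_sort_eq[OF srt]
    have eq: "set s0 \<union> (\<Union>(e, k, h)\<in>set l. {e, om e, om (om e)}) = {0..n-1}"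
      by (auto simp: split_def)
    obtain i where i: "0 \<le> i" "i < n" "e = dec i" by (rule obtain_dec)
    then have "i \<in> set s0 \<union> (\<Union>(e, k, h)\<in>set l. {e, om e, om (om e)})"
      unfolding eq by simp
    then consider "i \<in> set s0" | e' k h where "(e', k, h) \<in> set l" "i \<in> {e', om e', om (om e')}"
      by auto
    then show ?thesis
    proof cases
      case 1
      then obtain j where "j < length cl" "i = s0 ! j" using ls by (auto simp: in_set_conv_nth)
      then show ?thesis using i(3) by auto
    next
      case 2
      have r: "in_range n ks (e', k, h)" using lr 2(1) by (auto simp: list_all_iff)
      have ks: "set ks \<subseteq> {1..6}" using l by auto
      have k: "of_int k \<in> R" using l QR NR r by blast
      have k2: "2 * x \<in> R" if "x \<in> R" for x
        using that l by (auto simp: QR_def NR_def)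
      have P0: "Q_block \<omega> (of_int k) (dec e') (dec h) \<in> P0"
        using in_P0[of "Q_code n ad om (e', k, h)"] lb 2(1) unfolding tri_Q_code[OF r ks] by blast
      \<comment> \<open>Rotation replaces k by 2k, which stays in \<open>R\<close> because 2 is a
        square modulo 7.\<close>
      have rot: "\<exists>k\<in>R. \<exists>h. Q_block \<omega> k (\<omega> * d) h \<in> P0" if "\<exists>k\<in>R. \<exists>h. Q_block \<omega> k d h \<in> P0" for d
        using that Q_block_rotate[OF omega, of _ d] k2 by metis
      have *: "\<exists>k\<in>R. \<exists>h. Q_block \<omega> k (dec e') h \<in> P0" using P0 k by blast
      have "e \<in> {dec e', \<omega> * dec e', \<omega> * (\<omega> * dec e')}"
        using 2(2) i(3) by (auto simp: dec_om)
      then show ?thesis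
        using * rot[OF *] rot[OF rot[OF *]] by blast
    qed
  qed
  interpret K: kirkman_data \<omega> half third "{..<length cl}" "\<lambda>i. set (map (tri adec) (cl ! i))"
    "\<lambda>i. dec (sl ! i)" "\<lambda>i. dec (sl' ! i)" P0
  proof
    show "1 + \<omega> + \<omega> * \<omega> = 0" "2 * half = 1" "3 * third = 1" by fact+
    show "finite {..<length cl}" "CARD('a) + 1 = 2 * card {..<length cl}"
      using len by simp_all
    show "partition_on UNIV (set (map (tri adec) (cl ! i)))" if "i \<in> {..<length cl}" for i
      using base_partition(1)[of "cl ! i"] that by simp
    show "card B = 3" if "i \<in> {..<length cl}" "B \<in> set (map (tri adec) (cl ! i))" for i B
      using base_partition(2)[of "cl ! i"] that by simp
    have nth: "\<exists>i\<in>{..<length cl}. tri adec t \<in> set (map (tri adec) (cl ! i))" if tc: "t \<in> set (concat cl)" for t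
    proof -
      obtain c where "c \<in> set cl" "t \<in> set c" using tc by auto
      moreover obtain i where "i < length cl" "c = cl ! i"
        using \<open>c \<in> set cl\<close> by (auto simp: in_set_conv_nth)
      ultimately show ?thesis by auto
    qed
    show "\<exists>i\<in>{..<length cl}. \<exists>B\<in>set (map (tri adec) (cl ! i)). {x, y} \<subseteq> B" if "x \<noteq> y" for x y
      using base_pairs[OF that] nth unfolding paired_def by meson
    show "\<exists>i\<in>{..<length cl}. \<exists>B\<in>set (map (tri adec) (cl ! i)). \<exists>t. T = map_sum (\<lambda>h. h + t) id ` B"
      if "card T = 3" for T
      using base_triples[OF that] nth unfolding developed_def translate_def by meson
    have m: "7 * n + 1 + 1 = int CARD('a point)"
      by (simp add: n card_UNIV_sum)
    show "partition_on UNIV P0" "\<And>B. B \<in> P0 \<Longrightarrow> card B = 3"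
      using partition_tri[OF sort_bs pdec_surj m] unfolding P0_def by blast+
    show "\<exists>d\<in>QR. \<exists>h. Z_block d e h \<in> P0" for e
    proof -
      obtain i where i: "0 \<le> i" "i < n" "e = dec i" by (rule obtain_dec)
      then have "i \<in> fst ` set zs"
        using arg_cong[OF zs, of set] by simp
      then obtain d h where t: "(i, d, h) \<in> set zs" by auto
      have r: "in_range n [1, 2, 4] (i, d, h)"
        using t ranges(1) by (auto simp: list_all_iff)
      have "Z_code n ad sb (i, d, h) \<in> set bs"
        unfolding bs_def set_append set_map using t by blast
      then have "Z_block (of_int d) e (dec h) \<in> P0"
        using in_P0[of "Z_code n ad sb (i, d, h)"] unfolding tri_Z_code[OF r] i(3) by blast
      then show ?thesis using QR[OF r] by blast
    qed
    show "(\<exists>x\<in>QR. \<exists>h. D_block x e h \<in> P0) \<and> (\<exists>x\<in>NR. \<exists>h. D_block x e h \<in> P0)" if "e \<noteq> 0" for e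
      using D[OF that] by blast
    have I: "\<exists>x\<in>R. \<exists>h. I_block x h \<in> P0"
      if ex: "list_ex (\<lambda>(e, x, h). x \<in> S) ins" and SR: "\<And>x. x \<in> {1..6} \<Longrightarrow> x \<in> S \<Longrightarrow> of_int x \<in> R" for R S
    proof -
      obtain e x h where t: "(e, x, h) \<in> set ins" "x \<in> S"
        using ex by (auto simp: list_ex_iff)
      have r: "in_range n [1, 2, 3, 4, 5, 6] (e, x, h)"
        using t ranges(3) by (auto simp: list_all_iff)
      have x: "x \<in> {1..6}" using r by (auto simp: in_range_def)
      have "I_code n (e, x, h) \<in> set bs"
        unfolding bs_def set_append set_map using t by blast
      then have "I_block (of_int x) (dec h) \<in> P0"
        using in_P0[of "I_code n (e, x, h)"] unfolding tri_I_code[OF r sub(3)] by blast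
      then show ?thesis using SR[OF x t(2)] by blast
    qed
    show "(\<exists>x\<in>QR. \<exists>h. I_block x h \<in> P0) \<and> (\<exists>x\<in>NR. \<exists>h. I_block x h \<in> P0)"
      using I[OF ins(1), of QR] I[OF ins(2), of NR] of_int_QR by blast
    show "e \<in> (\<lambda>i. dec (sl ! i)) ` {..<length cl} \<or> (\<exists>k\<in>QR. \<exists>h. Q_block \<omega> k e h \<in> P0)" for e
      using Q[of qs "[1, 2, 4]" QR sl e] by blast
    show "e \<in> (\<lambda>i. dec (sl' ! i)) ` {..<length cl} \<or> (\<exists>k\<in>NR. \<exists>h. Q_block \<omega> k e h \<in> P0)" for e
      using Q[of rs "[3, 5, 6]" NR sl' e] by blast
  qed
  show ?thesis by (rule K.large_set_exists)
qed

end

section \<open>The five orders\<close>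

definition ad_mod :: "int \<Rightarrow> int \<Rightarrow> int \<Rightarrow> int" where "ad_mod n i j = (i + j) mod n"
definition sb_mod :: "int \<Rightarrow> int \<Rightarrow> int \<Rightarrow> int" where "sb_mod n i j = (i - j) mod n"
definition om_mod :: "int \<Rightarrow> int \<Rightarrow> int \<Rightarrow> int" where "om_mod n w i = (w * i) mod n"

lemma coding_mod:
  assumes n: "n = int CARD('a::{finite, comm_ring_1})" and n0: "(of_int n :: 'a) = 0"
    and surj: "(of_int :: int \<Rightarrow> 'a) ` {0..<n} = UNIV"
  shows "coding n (of_int :: int \<Rightarrow> 'a) (ad_mod n) (sb_mod n) (om_mod n w) (of_int w)"
proof -
  have m: "(of_int (z mod n) :: 'a) = of_int z" for z
  proof -
    have "(of_int z :: 'a) = of_int (n * (z div n) + z mod n)" by simp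
    also have "\<dots> = of_int n * of_int (z div n) + of_int (z mod n)" by (simp only: of_int_add of_int_mult)
    finally show ?thesis by (simp only: n0 mult_zero_left add_0_left)
  qed
  have pos: "0 < n" by (simp add: n)
  show ?thesis
  proof
    show "n = int CARD('a)" "(of_int :: int \<Rightarrow> 'a) ` {0..<n} = UNIV" "(of_int 0 :: 'a) = 0"
      using n surj by simp_all
    show "(of_int (ad_mod n i j) :: 'a) = of_int i + of_int j" "(of_int (sb_mod n i j) :: 'a) = of_int i - of_int j"
      "(of_int (om_mod n w i) :: 'a) = of_int w * of_int i" for i j
      by (simp_all add: ad_mod_def sb_mod_def om_mod_def m)
    show "ad_mod n i j \<in> {0..<n}" "sb_mod n i j \<in> {0..<n}" "om_mod n w i \<in> {0..<n}" for i j
      using pos by (simp_all add: ad_mod_def sb_mod_def om_mod_def)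
  qed
qed

text \<open>The type \<open>25\<close> is Z/25, where 1 + X + X^2 has no root, its discriminant -3
  being a nonsquare modulo 5. For the same reason adjoining a root to Z/5 gives a field.\<close>

datatype f25 = F25 (re: 5) (im: 5)

text \<open>The field with 25 elements: \<^term>\<open>F25 a b\<close> is \<open>a + b * \<omega>\<close>, where \<open>\<omega>\<^sup>2 + \<omega> + 1 = 0\<close>.\<close>

instantiation f25 :: comm_ring_1
begin
definition "0 = F25 0 0"
definition "1 = F25 1 0"
definition "x + y = F25 (re x + re y) (im x + im y)"
definition "x - y = F25 (re x - re y) (im x - im y)"
definition "- x = F25 (- re x) (- im x)"
definition "x * y = F25 (re x * re y - im x * im y) (re x * im y + im x * re y - im x * im y)"
instance
  by standard
    (simp_all add: zero_f25_def one_f25_def plus_f25_def minus_f25_def uminus_f25_def times_f25_def algebra_simps)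
end

lemma numeral_f25: "2 = F25 2 0" "3 = F25 3 0"
proof -
  have "(2::f25) = 1 + 1" "(3::f25) = 1 + 1 + 1" by simp_all
  then show "2 = F25 2 0" "3 = F25 3 0"
    by (simp_all only: plus_f25_def one_f25_def f25.sel f25.inject) simp_all
qed

lemma UNIV_f25: "(UNIV :: f25 set) = (\<lambda>(a, b). F25 a b) ` UNIV"
proof -
  have "x \<in> (\<lambda>(a, b). F25 a b) ` UNIV" for x
    by (rule image_eqI[of _ _ "(re x, im x)"]) simp_all
  then show ?thesis by blast
qed

instance f25 :: finite
  by standard (simp add: UNIV_f25)

lemma card_f25: "CARD(f25) = 25"
proof -
  have "inj (\<lambda>(a, b). F25 a b)" by (auto intro: injI)
  then show ?thesis unfolding UNIV_f25 by (simp add: card_image)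
qed

text \<open>The code 5a + b stands for b + a \<omega>; \<open>of_int i\<close> is b because 5 = 0 in
  the type \<open>5\<close>.\<close>

definition dec_25 :: "int \<Rightarrow> f25" where "dec_25 i = F25 (of_int i) (of_int (i div 5))"
definition ad_25 :: "int \<Rightarrow> int \<Rightarrow> int" where
  "ad_25 i j = 5 * ((i div 5 + j div 5) mod 5) + (i + j) mod 5"
definition sb_25 :: "int \<Rightarrow> int \<Rightarrow> int" where
  "sb_25 i j = 5 * ((i div 5 - j div 5) mod 5) + (i - j) mod 5"
text \<open>From \<omega>^2 = -1 - \<omega>, the product \<omega> (b + a \<omega>) is -a + (b - a)
  \<omega>.\<close>

definition om_25 :: "int \<Rightarrow> int" where
  "om_25 i = 5 * ((i - i div 5) mod 5) + (- (i div 5)) mod 5"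

lemma five_0: "(5 :: 5) = 0"
  by simp

lemma of_int_mod_5: "(of_int (z mod 5) :: 5) = of_int z"
proof -
  have "(of_int z :: 5) = of_int (5 * (z div 5) + z mod 5)" by simp
  also have "\<dots> = 5 * of_int (z div 5) + of_int (z mod 5)" by (simp only: of_int_add of_int_mult of_int_numeral)
  finally show ?thesis by (simp only: five_0 mult_zero_left add_0_left)
qed

lemma dec_25_simp: "0 \<le> b \<Longrightarrow> b < 5 \<Longrightarrow> dec_25 (5 * a + b) = F25 (of_int b) (of_int a)"
  by (simp add: dec_25_def five_0)

lemma coding_25: "coding 25 dec_25 ad_25 sb_25 om_25 (F25 0 1)"
proof
  show "25 = int CARD(f25)" by (simp add: card_f25)
  have "x \<in> dec_25 ` {0..<25}" for x
  proof -
    obtain i j where i: "re x = of_int i" "0 \<le> i" "i < 5" and j: "im x = of_int j" "0 \<le> j" "j < 5"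
      by (cases "re x"; cases "im x") auto
    have "x = dec_25 (5 * j + i)" using i j dec_25_simp[of i j] by (cases x) simp
    then show ?thesis using i j by (intro image_eqI) auto
  qed
  then show "dec_25 ` {0..<25} = UNIV" by blast
  show "dec_25 0 = 0" by (simp add: dec_25_def zero_f25_def)
  have m: "0 \<le> z mod 5" "z mod 5 < 5" for z :: int by simp_all
  show "dec_25 (ad_25 i j) = dec_25 i + dec_25 j" "dec_25 (sb_25 i j) = dec_25 i - dec_25 j" for i j
    unfolding ad_25_def sb_25_def dec_25_simp[OF m] of_int_mod_5
    by (simp_all add: dec_25_def plus_f25_def minus_f25_def)
  show "dec_25 (om_25 i) = F25 0 1 * dec_25 i" for i
    unfolding om_25_def dec_25_simp[OF m] of_int_mod_5
    by (simp add: dec_25_def times_f25_def)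
  have r: "5 * (a mod 5) + b mod 5 \<in> {0..<25}" for a b :: int
    using m[of a] m[of b] unfolding atLeastLessThan_iff by linarith
  show "ad_25 i j \<in> {0..<25}" "sb_25 i j \<in> {0..<25}" "om_25 i \<in> {0..<25}" for i j
    unfolding ad_25_def sb_25_def om_25_def by (rule r)+
qed

section \<open>Order 93 = 7 * 13 + 2\<close>

text \<open>
  In the data below, \<open>A\<close> and \<open>B\<close> are the arguments \<open>c0\<close> and \<open>cs\<close> of \<^const>\<open>base_classes\<close>. The parallel
  class \<open>P0\<close> consists of the blocks listed in \<open>Z\<close>, \<open>D\<close> and \<open>E\<close> (\<open>D_block\<close> at squares and nonsquares
  modulo 7), \<open>I\<close> (the first component is a dummy), \<open>Q\<close> and \<open>R\<close> (\<open>Q_block\<close> at squares and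
  nonsquares), while \<open>S\<close>, and \<open>T\<close> if it differs, list the values of \<open>\<alpha>\<close> and \<open>\<beta>\<close>.
\<close>

definition A_13 :: "triple list" where
  "A_13 =
   [(0, 13, 14), (1, 10, 11), (2, 3, 12), (4, 5, 9), (6, 7, 8)]"

definition B_13 :: "triple list list" where
  "B_13 =
   [[(0, 1, 8), (2, 6, 10), (3, 4, 14), (5, 11, 13), (7, 9, 12)],
    [(0, 2, 11), (1, 9, 14), (3, 6, 13), (4, 7, 10), (5, 8, 12)],
    [(0, 3, 9), (1, 5, 6), (2, 7, 13), (4, 11, 12), (8, 10, 14)],
    [(0, 4, 6), (1, 12, 13), (2, 8, 9), (3, 5, 10), (7, 11, 14)],
    [(0, 5, 7), (1, 2, 4), (3, 8, 11), (6, 12, 14), (9, 10, 13)],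
    [(0, 10, 12), (1, 3, 7), (2, 5, 14), (4, 8, 13), (6, 9, 11)]]"

definition Z_13 :: "triple list" where
  "Z_13 =
   [(0, 1, 5), (1, 2, 10), (2, 4, 12), (3, 4, 8), (4, 2, 11), (5, 4, 4), (6, 2, 7), (7, 1, 9), (8, 1, 6),
    (9, 2, 1), (10, 1, 0), (11, 4, 2), (12, 1, 3)]"

definition D_13 :: "triple list" where
  "D_13 =
   [(1, 1, 8), (2, 1, 10), (3, 4, 7), (4, 2, 8), (5, 2, 1), (6, 4, 12)]"

definition E_13 :: "triple list" where
  "E_13 =
   [(1, 6, 7), (2, 3, 11), (3, 5, 3), (4, 5, 8), (5, 6, 5), (6, 3, 0)]"

definition I_13 :: "triple list" where
  "I_13 =
   [(0, 2, 3), (0, 5, 2)]"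

definition Q_13 :: "triple list" where
  "Q_13 =
   [(4, 1, 4), (7, 4, 12)]"

definition R_13 :: "triple list" where
  "R_13 =
   [(4, 5, 11), (7, 6, 9)]"

text \<open>0 and two of the four orbits of multiplication by 3; \<open>Q_13\<close> and
  \<open>R_13\<close> represent the other two. This leaves (n + 1)/2 = 7 parameters, one for each
  small class.\<close>

definition S_13 :: "int list" where
  "S_13 =
   [0, 1, 3, 9, 2, 6, 5]"

lemma base_classes_ok_13:
  "base_classes_ok 13 (sb_mod 13) (om_mod 13 1) 1 [0, 1, 2, 3, 4, 5, 6, 7, 8, 9, 10, 11, 12, 13, 14] A_13 B_13"
  by code_simp

lemma orbit_class_ok_13:
  "orbit_class_ok 13 (ad_mod 13) (sb_mod 13) (om_mod 13 3) S_13 S_13 Z_13 D_13 E_13 I_13 Q_13 R_13"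
  by code_simp

lemma coding_13: "coding 13 (of_int :: int \<Rightarrow> 13) (ad_mod 13) (sb_mod 13) (om_mod 13 w) (of_int w)"
proof (rule coding_mod)
  have "x \<in> of_int ` {0..<13}" for x :: 13
    by (cases x) auto
  then show "(of_int :: int \<Rightarrow> 13) ` {0..<13} = UNIV" by blast
qed simp_all

theorem large_set_KTS_93: "\<exists>(X :: nat set) \<L>. large_set_KTS 93 X \<L>"
proof -
  \<comment> \<open>The multiplier is 1, so each of the 15 points represents itself.\<close>
  interpret multiplied_coding 13 "of_int :: int \<Rightarrow> 13" "ad_mod 13" "sb_mod 13" "om_mod 13 3" "of_int 3"
      "om_mod 13 1" "of_int 1" "of_int 1" 1 "[0, 1, 2, 3, 4, 5, 6, 7, 8, 9, 10, 11, 12, 13, 14]" A_13 B_13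
  proof (intro multiplied_coding.intro multiplied_coding_axioms.intro)
    show "of_int 1 * of_int 1 = (1 :: 13)" by simp
  qed (rule coding_13 base_classes_ok_13 coding.dec_om[OF coding_13] coding.om_range[OF coding_13])+
  \<comment> \<open>3 is a primitive cube root of unity modulo 13. The locales assume a ring only,
    so units come with explicit inverses: here 7 of 2 and 9 of 3, and likewise for the later
    orders.\<close>
  have "1 + of_int 3 + of_int 3 * of_int 3 = (0 :: 13)" "2 * 7 = (1 :: 13)" "3 * 9 = (1 :: 13)"
    by simp_all
  from large_set_from_codes[OF this orbit_class_ok_13]
  show ?thesis
    by (simp add: base_classes_def length_concat_iterates B_13_def S_13_def)
qed

section \<open>Order 177 = 7 * 25 + 2\<close>

definition A_25 :: "triple list" where
  "A_25 =
   [(0, 25, 26), (1, 5, 24), (2, 10, 18), (3, 12, 15), (4, 6, 20), (7, 9, 19), (8, 13, 14), (11, 21, 23),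
    (16, 17, 22)]"

text \<open>Multiplication by \<omega> fixes \<open>A_25\<close>, whose finite blocks are the cosets
  of the cube roots of unity \<open>{1, 5, 24}\<close>. The multiples of the four classes here are
  the other 12 classes.\<close>

definition B_25 :: "triple list list" where
  "B_25 =
   [[(0, 1, 4), (2, 8, 20), (3, 5, 22), (6, 11, 18), (7, 14, 21), (9, 16, 23), (10, 17, 25),
     (12, 19, 24), (13, 15, 26)],
    [(0, 2, 3), (1, 11, 25), (4, 19, 26), (5, 12, 13), (6, 7, 16), (8, 9, 10), (14, 23, 24),
     (15, 21, 22), (17, 18, 20)],
    [(0, 7, 23), (1, 9, 22), (2, 14, 17), (3, 13, 16), (4, 8, 21), (5, 18, 26), (6, 15, 19),
     (10, 11, 24), (12, 20, 25)],
    [(0, 8, 22), (1, 2, 19), (3, 4, 11), (5, 6, 17), (7, 15, 18), (9, 14, 25), (10, 12, 23),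
     (13, 20, 24), (16, 21, 26)]]"

definition Z_25 :: "triple list" where
  "Z_25 =
   [(0, 1, 17), (1, 2, 22), (2, 2, 24), (3, 4, 16), (4, 1, 4), (5, 4, 7), (6, 2, 12), (7, 1, 23),
    (8, 1, 11), (9, 4, 9), (10, 2, 2), (11, 1, 18), (12, 4, 13), (13, 1, 1), (14, 1, 6), (15, 1, 20),
    (16, 1, 19), (17, 1, 10), (18, 2, 21), (19, 4, 3), (20, 2, 5), (21, 4, 15), (22, 4, 14), (23, 1, 8),
    (24, 1, 0)]"

definition D_25 :: "triple list" where
  "D_25 =
   [(1, 4, 20), (2, 4, 2), (5, 2, 12), (6, 2, 7), (7, 1, 11), (8, 1, 0), (9, 2, 4), (10, 2, 9), (11, 4, 9),
    (12, 2, 16), (13, 2, 23), (14, 4, 19)]"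

definition E_25 :: "triple list" where
  "E_25 =
   [(1, 3, 12), (2, 3, 23), (5, 5, 8), (6, 3, 16), (7, 5, 22), (8, 3, 11), (9, 6, 15), (10, 6, 11),
    (11, 5, 16), (12, 5, 7), (13, 5, 1), (14, 5, 10)]"

definition I_25 :: "triple list" where
  "I_25 =
   [(0, 1, 7), (0, 6, 4)]"

definition Q_25 :: "triple list" where
  "Q_25 =
   [(7, 2, 2), (8, 4, 18), (11, 2, 16), (16, 1, 6)]"

definition R_25 :: "triple list" where
  "R_25 =
   [(7, 3, 5), (8, 3, 6), (11, 5, 9), (16, 5, 12)]"

definition S_25 :: "int list" where
  "S_25 =
   [0, 1, 5, 24, 2, 10, 18, 3, 15, 12, 4, 20, 6]"

lemma base_classes_ok_25:
  "base_classes_ok 25 sb_25 om_25 3 [0, 1, 2, 3, 4, 7, 8, 11, 16, 25, 26] A_25 B_25"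
  by code_simp

lemma orbit_class_ok_25:
  "orbit_class_ok 25 ad_25 sb_25 om_25 S_25 S_25 Z_25 D_25 E_25 I_25 Q_25 R_25"
  by code_simp

theorem large_set_KTS_177: "\<exists>(X :: nat set) \<L>. large_set_KTS 177 X \<L>"
proof -
  \<comment> \<open>The multiplier is \<omega> itself, of order 3; its inverse
    \<open>F25 4 4\<close> is -1 - \<omega> = \<omega>^2.\<close>
  interpret multiplied_coding 25 dec_25 ad_25 sb_25 om_25 "F25 0 1" om_25 "F25 0 1" "F25 4 4" 3 "[0, 1, 2, 3, 4, 7, 8, 11, 16, 25, 26]" A_25 B_25
  proof (intro multiplied_coding.intro multiplied_coding_axioms.intro)
    show "F25 0 1 * F25 4 4 = 1" by (simp add: times_f25_def one_f25_def)
  qed (rule coding_25 base_classes_ok_25 coding.dec_om[OF coding_25] coding.om_range[OF coding_25])+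
  have "1 + F25 0 1 + F25 0 1 * F25 0 1 = (0 :: f25)" "2 * F25 3 0 = (1 :: f25)" "3 * F25 2 0 = (1 :: f25)"
    by (simp add: plus_f25_def times_f25_def one_f25_def zero_f25_def numeral_f25)+
  from large_set_from_codes[OF this orbit_class_ok_25]
  show ?thesis
    by (simp add: base_classes_def length_concat_iterates B_25_def S_25_def card_f25)
qed

section \<open>Order 219 = 7 * 31 + 2\<close>

definition A_31 :: "triple list" where
  "A_31 =
   [(0, 31, 32), (1, 5, 25), (2, 10, 19), (3, 13, 15), (4, 7, 20), (6, 26, 30), (8, 9, 14), (11, 24, 27),
    (12, 21, 29), (16, 18, 28), (17, 22, 23)]"

definition B_31 :: "triple list list" where
  "B_31 =
   [[(0, 1, 30), (2, 12, 20), (3, 14, 32), (4, 8, 26), (5, 23, 27), (6, 7, 18), (9, 10, 16),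
     (11, 19, 29), (13, 24, 25), (15, 21, 22), (17, 28, 31)]]"

text \<open>The parallel class for this order is invariant under multiplying H by 2, which has order
  5 modulo 31.\<close>

definition Z_31 :: "triple list" where
  "Z_31 =
   [(0, 1, 0), (1, 4, 26), (2, 4, 21), (3, 1, 29), (4, 4, 11), (5, 1, 2), (6, 1, 27), (7, 4, 10),
    (8, 4, 22), (9, 1, 16), (10, 1, 4), (11, 1, 7), (12, 1, 23), (13, 1, 28), (14, 4, 20), (15, 4, 17),
    (16, 4, 13), (17, 1, 30), (18, 1, 1), (19, 4, 5), (20, 1, 8), (21, 1, 19), (22, 1, 14), (23, 4, 24),
    (24, 1, 15), (25, 4, 18), (26, 1, 25), (27, 4, 12), (28, 4, 9), (29, 4, 6), (30, 4, 3)]"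

definition D_31 :: "triple list" where
  "D_31 =
   [(1, 1, 16), (2, 1, 1), (3, 2, 27), (4, 1, 2), (5, 2, 9), (6, 2, 23), (7, 2, 30), (8, 1, 4), (9, 2, 10),
    (10, 2, 18), (11, 2, 5), (12, 2, 15), (13, 2, 20), (14, 2, 29), (15, 1, 8)]"

definition E_31 :: "triple list" where
  "E_31 =
   [(1, 5, 21), (2, 5, 11), (3, 6, 21), (4, 5, 22), (5, 5, 20), (6, 6, 11), (7, 6, 13), (8, 5, 13),
    (9, 5, 5), (10, 5, 9), (11, 5, 18), (12, 6, 22), (13, 5, 10), (14, 6, 26), (15, 5, 26)]"

definition I_31 :: "triple list" where
  "I_31 =
   [(0, 2, 0), (0, 5, 0)]"

definition Q_31 :: "triple list" where
  "Q_31 =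
   [(1, 4, 25), (2, 4, 19), (4, 4, 7), (8, 4, 14), (16, 4, 28)]"

definition R_31 :: "triple list" where
  "R_31 =
   [(1, 6, 16), (2, 6, 1), (4, 6, 2), (8, 6, 4), (16, 6, 8)]"

definition S_31 :: "int list" where
  "S_31 =
   [0, 3, 13, 15, 6, 26, 30, 11, 27, 24, 12, 21, 29, 17, 22, 23]"

lemma base_classes_ok_31:
  "base_classes_ok 31 (sb_mod 31) (om_mod 31 9) 15 [0, 1, 3, 31, 32] A_31 B_31"
  by code_simp

lemma orbit_class_ok_31:
  "orbit_class_ok 31 (ad_mod 31) (sb_mod 31) (om_mod 31 25) S_31 S_31 Z_31 D_31 E_31 I_31 Q_31 R_31"
  by code_simp

lemma coding_31: "coding 31 (of_int :: int \<Rightarrow> 31) (ad_mod 31) (sb_mod 31) (om_mod 31 w) (of_int w)"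
proof (rule coding_mod)
  have "x \<in> of_int ` {0..<31}" for x :: 31
    by (cases x) auto
  then show "(of_int :: int \<Rightarrow> 31) ` {0..<31} = UNIV" by blast
qed simp_all

theorem large_set_KTS_219: "\<exists>(X :: nat set) \<L>. large_set_KTS 219 X \<L>"
proof -
  \<comment> \<open>9 generates the 15 nonzero squares modulo 31, with inverse 7; 1 and 3 represent
    squares and nonsquares.\<close>
  interpret multiplied_coding 31 "of_int :: int \<Rightarrow> 31" "ad_mod 31" "sb_mod 31" "om_mod 31 25" "of_int 25"
      "om_mod 31 9" "of_int 9" "of_int 7" 15 "[0, 1, 3, 31, 32]" A_31 B_31
  proof (intro multiplied_coding.intro multiplied_coding_axioms.intro)
    show "of_int 9 * of_int 7 = (1 :: 31)" by simp
  qed (rule coding_31 base_classes_ok_31 coding.dec_om[OF coding_31] coding.om_range[OF coding_31])+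
  have "1 + of_int 25 + of_int 25 * of_int 25 = (0 :: 31)" "2 * 16 = (1 :: 31)" "3 * 21 = (1 :: 31)"
    by simp_all
  from large_set_from_codes[OF this orbit_class_ok_31]
  show ?thesis
    by (simp add: base_classes_def length_concat_iterates B_31_def S_31_def)
qed

section \<open>Order 261 = 7 * 37 + 2\<close>

definition A_37 :: "triple list" where
  "A_37 =
   [(0, 37, 38), (1, 10, 26), (2, 15, 20), (3, 4, 30), (5, 13, 19), (6, 8, 23), (7, 33, 34), (9, 12, 16),
    (11, 27, 36), (14, 29, 31), (17, 22, 35), (18, 24, 32), (21, 25, 28)]"

definition B_37 :: "triple list list" where
  "B_37 =
   [[(0, 1, 35), (2, 3, 25), (4, 6, 9), (5, 7, 38), (8, 19, 28), (10, 33, 36), (11, 17, 18),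
     (12, 27, 32), (13, 14, 16), (15, 34, 37), (20, 21, 24), (22, 30, 31), (23, 26, 29)],
    [(0, 2, 21), (1, 4, 27), (3, 34, 36), (5, 29, 32), (6, 28, 35), (7, 13, 22), (8, 11, 37),
     (9, 10, 15), (12, 24, 26), (14, 30, 38), (16, 19, 20), (17, 25, 33), (18, 23, 31)]]"

definition Z_37 :: "triple list" where
  "Z_37 =
   [(0, 1, 0), (1, 2, 25), (2, 4, 1), (3, 4, 11), (4, 2, 27), (5, 2, 15), (6, 1, 19), (7, 4, 32),
    (8, 4, 13), (9, 1, 7), (10, 4, 28), (11, 4, 8), (12, 4, 34), (13, 4, 2), (14, 1, 17), (15, 2, 26),
    (16, 2, 33), (17, 2, 31), (18, 1, 3), (19, 1, 20), (20, 1, 10), (21, 2, 9), (22, 4, 14), (23, 2, 5),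
    (24, 4, 4), (25, 4, 16), (26, 1, 21), (27, 2, 23), (28, 1, 12), (29, 2, 22), (30, 1, 36), (31, 4, 35),
    (32, 2, 30), (33, 1, 24), (34, 2, 18), (35, 1, 29), (36, 1, 6)]"

definition D_37 :: "triple list" where
  "D_37 =
   [(1, 1, 12), (2, 4, 14), (3, 4, 10), (4, 2, 1), (5, 1, 27), (6, 4, 4), (8, 2, 30), (9, 1, 6),
    (10, 2, 9), (12, 4, 8), (13, 2, 11), (15, 2, 31), (16, 2, 23), (19, 4, 36), (20, 1, 29), (23, 1, 3),
    (26, 4, 16), (30, 1, 26)]"

definition E_37 :: "triple list" where
  "E_37 =
   [(1, 3, 14), (2, 3, 8), (3, 6, 27), (4, 3, 36), (5, 6, 10), (6, 3, 18), (8, 5, 24), (9, 5, 6),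
    (10, 6, 29), (12, 6, 8), (13, 5, 26), (15, 5, 23), (16, 3, 23), (19, 3, 1), (20, 6, 6), (23, 6, 32),
    (26, 5, 31), (30, 5, 11)]"

definition I_37 :: "triple list" where
  "I_37 =
   [(0, 2, 0), (0, 5, 0)]"

definition Q_37 :: "triple list" where
  "Q_37 =
   [(19, 1, 35), (31, 1, 24), (36, 1, 4), (26, 1, 7), (30, 1, 28), (17, 1, 6)]"

definition R_37 :: "triple list" where
  "R_37 =
   [(10, 6, 34), (3, 6, 25), (5, 6, 17), (25, 6, 11), (34, 6, 12), (2, 6, 29)]"

definition S_37 :: "int list" where
  "S_37 =
   [0, 2, 20, 15, 6, 23, 8, 7, 33, 34, 9, 16, 12, 18, 32, 24, 21, 25, 28]"

definition T_37 :: "int list" where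
  "T_37 =
   [0, 6, 23, 8, 9, 16, 12, 11, 36, 27, 14, 29, 31, 17, 22, 35, 18, 32, 24]"

lemma base_classes_ok_37:
  "base_classes_ok 37 (sb_mod 37) (om_mod 37 16) 9 [0, 1, 2, 3, 5, 37, 38] A_37 B_37"
  by code_simp

lemma orbit_class_ok_37:
  "orbit_class_ok 37 (ad_mod 37) (sb_mod 37) (om_mod 37 10) S_37 T_37 Z_37 D_37 E_37 I_37 Q_37 R_37"
  by code_simp

lemma coding_37: "coding 37 (of_int :: int \<Rightarrow> 37) (ad_mod 37) (sb_mod 37) (om_mod 37 w) (of_int w)"
proof (rule coding_mod)
  have "x \<in> of_int ` {0..<37}" for x :: 37
    by (cases x) auto
  then show "(of_int :: int \<Rightarrow> 37) ` {0..<37} = UNIV" by blast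
qed simp_all

theorem large_set_KTS_261: "\<exists>(X :: nat set) \<L>. large_set_KTS 261 X \<L>"
proof -
  \<comment> \<open>16 generates the nonzero fourth powers modulo 37, a group of order 9 whose
    cosets are represented by 1, 2, 3 and 5.\<close>
  interpret multiplied_coding 37 "of_int :: int \<Rightarrow> 37" "ad_mod 37" "sb_mod 37" "om_mod 37 10" "of_int 10"
      "om_mod 37 16" "of_int 16" "of_int 7" 9 "[0, 1, 2, 3, 5, 37, 38]" A_37 B_37
  proof (intro multiplied_coding.intro multiplied_coding_axioms.intro)
    show "of_int 16 * of_int 7 = (1 :: 37)" by simp
  qed (rule coding_37 base_classes_ok_37 coding.dec_om[OF coding_37] coding.om_range[OF coding_37])+
  have "1 + of_int 10 + of_int 10 * of_int 10 = (0 :: 37)" "2 * 19 = (1 :: 37)" "3 * 25 = (1 :: 37)"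
    by simp_all
  from large_set_from_codes[OF this orbit_class_ok_37]
  show ?thesis
    by (simp add: base_classes_def length_concat_iterates B_37_def S_37_def T_37_def)
qed

section \<open>Order 303 = 7 * 43 + 2\<close>

definition A_43 :: "triple list" where
  "A_43 =
   [(0, 43, 44), (1, 6, 36), (2, 12, 29), (3, 18, 22), (4, 15, 24), (5, 8, 30), (7, 37, 42), (9, 11, 23),
    (10, 16, 17), (13, 35, 38), (14, 31, 41), (19, 28, 39), (20, 32, 34), (21, 25, 40), (26, 27, 33)]"

definition B_43 :: "triple list list" where
  "B_43 =
   [[(0, 1, 19), (2, 3, 42), (4, 18, 39), (5, 16, 21), (6, 12, 35), (7, 13, 20), (8, 24, 32),
     (9, 17, 38), (10, 26, 43), (11, 30, 44), (14, 23, 27), (15, 25, 34), (22, 40, 41), (28, 31, 36),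
     (29, 33, 37)]]"

definition Z_43 :: "triple list" where
  "Z_43 =
   [(0, 2, 0), (1, 2, 37), (2, 2, 18), (3, 4, 17), (4, 2, 19), (5, 4, 14), (6, 4, 32), (7, 2, 40),
    (8, 2, 29), (9, 4, 41), (10, 4, 39), (11, 2, 20), (12, 4, 25), (13, 4, 21), (14, 4, 16), (15, 4, 11),
    (16, 2, 33), (17, 4, 1), (18, 2, 23), (19, 4, 36), (20, 4, 13), (21, 2, 3), (22, 2, 26), (23, 4, 8),
    (24, 4, 42), (25, 4, 4), (26, 2, 38), (27, 2, 28), (28, 2, 31), (29, 2, 6), (30, 2, 24), (31, 4, 22),
    (32, 2, 30), (33, 4, 15), (34, 2, 10), (35, 2, 5), (36, 4, 35), (37, 4, 9), (38, 4, 2), (39, 2, 7),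
    (40, 4, 27), (41, 2, 12), (42, 2, 34)]"

definition D_43 :: "triple list" where
  "D_43 =
   [(1, 4, 12), (2, 4, 19), (3, 1, 27), (4, 4, 5), (5, 1, 2), (6, 1, 32), (7, 1, 34), (8, 4, 33),
    (9, 1, 30), (10, 1, 39), (11, 4, 3), (12, 1, 22), (13, 1, 29), (14, 1, 18), (15, 1, 7), (16, 4, 20),
    (17, 1, 28), (18, 1, 26), (19, 1, 42), (20, 1, 8), (21, 4, 37)]"

definition E_43 :: "triple list" where
  "E_43 =
   [(1, 3, 36), (2, 3, 14), (3, 6, 13), (4, 3, 15), (5, 6, 36), (6, 6, 17), (7, 6, 32), (8, 3, 13),
    (9, 6, 8), (10, 6, 14), (11, 3, 9), (12, 6, 9), (13, 6, 2), (14, 6, 22), (15, 6, 42), (16, 3, 17),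
    (17, 6, 39), (18, 6, 27), (19, 6, 25), (20, 6, 15), (21, 3, 25)]"

definition I_43 :: "triple list" where
  "I_43 =
   [(0, 4, 0), (0, 3, 0)]"

definition Q_43 :: "triple list" where
  "Q_43 =
   [(1, 2, 26), (4, 2, 18), (9, 1, 19), (10, 4, 2), (13, 1, 37), (14, 1, 20), (21, 2, 30)]"

definition R_43 :: "triple list" where
  "R_43 =
   [(1, 5, 23), (4, 5, 6), (9, 6, 29), (10, 3, 40), (13, 6, 18), (14, 6, 26), (21, 5, 10)]"

definition S_43 :: "int list" where
  "S_43 =
   [0, 2, 12, 29, 3, 18, 22, 5, 30, 8, 7, 42, 37, 19, 28, 39, 20, 34, 32, 26, 27, 33]"

lemma base_classes_ok_43:
  "base_classes_ok 43 (sb_mod 43) (om_mod 43 9) 21 [0, 1, 2, 43, 44] A_43 B_43"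
  by code_simp

lemma orbit_class_ok_43:
  "orbit_class_ok 43 (ad_mod 43) (sb_mod 43) (om_mod 43 6) S_43 S_43 Z_43 D_43 E_43 I_43 Q_43 R_43"
  by code_simp

lemma coding_43: "coding 43 (of_int :: int \<Rightarrow> 43) (ad_mod 43) (sb_mod 43) (om_mod 43 w) (of_int w)"
proof (rule coding_mod)
  have "x \<in> of_int ` {0..<43}" for x :: 43
    by (cases x) auto
  then show "(of_int :: int \<Rightarrow> 43) ` {0..<43} = UNIV" by blast
qed simp_all

theorem large_set_KTS_303: "\<exists>(X :: nat set) \<L>. large_set_KTS 303 X \<L>"
proof -
  \<comment> \<open>9 generates the 21 nonzero squares modulo 43, with inverse 24; 2 represents the
    nonsquares.\<close>
  interpret multiplied_coding 43 "of_int :: int \<Rightarrow> 43" "ad_mod 43" "sb_mod 43" "om_mod 43 6" "of_int 6"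
      "om_mod 43 9" "of_int 9" "of_int 24" 21 "[0, 1, 2, 43, 44]" A_43 B_43
  proof (intro multiplied_coding.intro multiplied_coding_axioms.intro)
    show "of_int 9 * of_int 24 = (1 :: 43)" by simp
  qed (rule coding_43 base_classes_ok_43 coding.dec_om[OF coding_43] coding.om_range[OF coding_43])+
  have "1 + of_int 6 + of_int 6 * of_int 6 = (0 :: 43)" "2 * 22 = (1 :: 43)" "3 * 29 = (1 :: 43)"
    by simp_all
  from large_set_from_codes[OF this orbit_class_ok_43]
  show ?thesis
    by (simp add: base_classes_def length_concat_iterates B_43_def S_43_def)
qed

theorem corollary3p8:
  shows "\<forall>v \<in> {93, 177, 219, 261, 303 :: nat}.
           \<exists>(X :: nat set) \<L>. large_set_KTS v X \<L>"
  using large_set_KTS_93 large_set_KTS_177 large_set_KTS_219 large_set_KTS_261 large_set_KTS_303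
  by simp

end
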